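(* For every positive integer $k$, there exists a group divisible triangle design $(V,\mathcal{G},\mathcal{B})$ of order $6k$ with groups of dimension $6$ over $\mathbb{F}_2$, where $V$ is a $k$-dimensional vector space over $\mathbb{F}_{2^6}$ (viewed as a $6k$-dimensional vector space over $\mathbb{F}_2$) and $\mathcal{G}$ is the set of all $1$-dimensional $\mathbb{F}_{2^6}$-subspaces of $V$.
   Context: For a vector space $V$ over $\mathbb{F}_q$, a triangle is a set $\{\langle a,b\rangle,\langle b,c\rangle,\langle c,a\rangle\}$ of three $2$-dimensional $\mathbb{F}_q$-subspaces, where $a,b,c\in V$ are linearly independent over $\mathbb{F}_q$. Let $m$ divide $n$. A group divisible triangle design of order $n$ with groups of dimension $m$ over $\mathbb{F}_q$ is a triple $(V,\mathcal{G},\mathcal{B})$, where $V$ is an $n$-dimensional vector space over $\mathbb{F}_q$, $\mathcal{G}$ is a set of $m$-dimensional subspaces of $V$ (groups) such that every nonzero vector of $V$ lies in exactly one of them, and $\mathcal{B}$ is a set of triangles in $V$, such that every $2$-dimensional $\mathbb{F}_q$-subspace of $V$ either is one of the three subspaces of exactly one triangle in $\mathcal{B}$ and is contained in no group, or belongs to no triangle of $\mathcal{B}$ and is contained in one group. *)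

theory Defs
  imports Complex_Main "HOL-Library.Z2"
begin

instance bit :: finite
proof
  have "finite {0, 1 :: bit}"
    by blast
  moreover have "(UNIV :: bit set) \<subseteq> {0, 1}"
    using bit_not_one_iff by blast
  ultimately show "finite (UNIV :: bit set)"
    by (rule finite_subset [rotated])
qed

context vector_space
begin

definition triangle :: "'b set set \<Rightarrow> bool"
  where "triangle T \<longleftrightarrow>
    (\<exists>a b c. distinct [a, b, c] \<and> independent {a, b, c} \<and>
      T = {span {a, b}, span {b, c}, span {c, a}})"

end

text \<open>
  The vector space is the whole type \<open>'v\<close> over the finite field given by the type \<open>'q\<close>.
  Finite dimensionality is required explicitly because \<open>dim\<close> assigns 0 to infinite-dimensional spaces.
\<close>

locale group_divisible_triangle_design = vector_space scale
  for scale :: "'q::{field, finite} \<Rightarrow> 'v::ab_group_add \<Rightarrow> 'v" +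
  fixes n m :: nat
    and groups :: "'v set set"
    and blocks :: "'v set set set"
  assumes m_dvd_n: "m dvd n"
    and finite_dimensional: "\<exists>S. finite S \<and> span S = UNIV"
    and dim_UNIV: "dim UNIV = n"
    and groups_subspace: "\<And>W. W \<in> groups \<Longrightarrow> subspace W \<and> dim W = m"
    and groups_partition: "\<And>v. v \<noteq> 0 \<Longrightarrow> \<exists>!W. W \<in> groups \<and> v \<in> W"
    and blocks_triangle: "\<And>T. T \<in> blocks \<Longrightarrow> triangle T"
    and line_cases: "\<And>U. subspace U \<Longrightarrow> dim U = 2 \<Longrightarrow>
      (\<exists>!T. T \<in> blocks \<and> U \<in> T) \<and> \<not> (\<exists>W\<in>groups. U \<subseteq> W) \<or>
      \<not> (\<exists>T\<in>blocks. U \<in> T) \<and> (\<exists>!W. W \<in> groups \<and> U \<subseteq> W)"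

text \<open>
  Restriction of scalars to the field \<open>bit\<close> with two elements. This is a vector space structure
  whenever \<open>'f\<close> has characteristic 2, \<open>of_bit\<close> then being the embedding of the prime field.
\<close>

definition scale_bit :: "('f::field \<Rightarrow> 'v::ab_group_add \<Rightarrow> 'v) \<Rightarrow> bit \<Rightarrow> 'v \<Rightarrow> 'v"
  where "scale_bit scale c v = scale (of_bit c) v"

end

theory Submission
  imports Defs "HOL-Computational_Algebra.Polynomial" "HOL-Library.Disjoint_Sets"
    "HOL-Library.Product_Plus"
begin

text \<open>
  A line lying in no group spans a plane over \<open>F = GF(64)\<close>, so it suffices to partition, for the plane
  \<open>F \<times> F\<close>, the lines that are not contained in a 1-dimensional \<open>F\<close>-subspace into triangles.

  Sort these lines \<open>U\<close> by their image under the first projection. If the image is \<open>{0, x, y, x + y}\<close> with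
  \<open>x, y\<close> independent, then \<open>U\<close> is determined by the slopes \<open>p \<noteq> r\<close> of its points over \<open>x\<close> and \<open>y\<close>, and
  the maps \<open>p \<mapsto> c p + t\<close> with \<open>c\<close> a nonzero cube act freely on such pairs with three orbits, told
  apart by the cubic character \<open>(p + r)\<^sup>2\<^sup>1\<close>. A triangle whose sides belong to the three different orbits
  therefore yields a partition, and it exists because the cyclotomic numbers of order 3 of \<open>F\<close>,
  except possibly \<open>(0, 0)\<close>, are positive. If the image is \<open>{0, v}\<close>, then \<open>U\<close> is an edge of the complete
  graph on \<open>{v} \<times> F\<close>; the edges avoiding \<open>(v, 0)\<close> are partitioned by the triangles
  \<open>(v, w), (v, w'), (v, w + w')\<close>, but the edges at \<open>(v, 0)\<close> are left over.

  The leftover lines are matched with two other kinds of lines: those with points \<open>(0, \<omega>\<^sup>2 s), (y, s)\<close>,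
  \<open>\<omega>\<close> a primitive cube root of unity, which form whole triangles of the second family, and lines
  through \<open>(v, 0)\<close> and \<open>(y, s)\<close> with \<open>{0, v, y, v + y}\<close> a multiple of \<open>{0, 1, \<zeta>, 1 + \<zeta>}\<close>, where \<open>\<zeta>\<close> is a
  primitive ninth root of unity. As \<open>1, \<zeta>, 1 + \<zeta>\<close> lie in different cubic classes, the latter can be
  chosen to form whole triangles of the first family as well.
\<close>

section \<open>Sets of lines that can be partitioned into triangles\<close>

text \<open>In characteristic 2 this is the span of \<open>a\<close> and \<open>b\<close> over F_2.
  Dependent arguments are allowed, because a projection may shrink a line to
  \<open>{0, v}\<close>.\<close>

definition line :: "'a::ab_group_add \<Rightarrow> 'a \<Rightarrow> 'a set"
  where "line a b = {0, a, b, a + b}"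

text \<open>In characteristic 2 the conditions on \<open>a\<close>, \<open>b\<close>,
  \<open>c\<close> say that they are independent over F_2. Phrased without scalars, the notion
  serves both \<open>F \<times> F\<close> and the vector space.\<close>

definition is_triangle :: "'a::ab_group_add set set \<Rightarrow> bool"
  where "is_triangle T \<longleftrightarrow>
    (\<exists>a b c. a \<noteq> 0 \<and> b \<noteq> 0 \<and> a \<noteq> b \<and> c \<notin> line a b \<and> T = {line a b, line b c, line c a})"

definition triangulable :: "'a::ab_group_add set set \<Rightarrow> bool"
  where "triangulable L \<longleftrightarrow>
    (\<exists>B. (\<forall>T\<in>B. is_triangle T \<and> T \<subseteq> L) \<and> (\<forall>U\<in>L. \<exists>!T. T \<in> B \<and> U \<in> T))"

lemma line_0: "line 0 v = {0, v}"
  by (auto simp: line_def)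

lemma line_commute: "line a b = line b a"
  by (auto simp: line_def add.commute)

lemma triangulable_UN:
  assumes "\<And>i. i \<in> I \<Longrightarrow> triangulable (L i)" and "disjoint_family_on L I"
  shows "triangulable (\<Union>i\<in>I. L i)"
proof -
  let ?P = "\<lambda>i B. (\<forall>T\<in>B. is_triangle T \<and> T \<subseteq> L i) \<and> (\<forall>U\<in>L i. \<exists>!T. T \<in> B \<and> U \<in> T)"
  have "\<forall>i\<in>I. \<exists>B. ?P i B"
    using assms(1) by (simp add: triangulable_def)
  then obtain B where "\<forall>i\<in>I. ?P i (B i)"
    by (rule bchoice[THEN exE])
  then have B: "\<And>i T. i \<in> I \<Longrightarrow> T \<in> B i \<Longrightarrow> is_triangle T \<and> T \<subseteq> L i"
      "\<And>i U. i \<in> I \<Longrightarrow> U \<in> L i \<Longrightarrow> \<exists>!T. T \<in> B i \<and> U \<in> T"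
    by simp_all
  have "\<exists>!T. T \<in> (\<Union>i\<in>I. B i) \<and> U \<in> T" if i: "i \<in> I" "U \<in> L i" for i U
  proof (rule ex_ex1I)
    show "\<exists>T. T \<in> (\<Union>i\<in>I. B i) \<and> U \<in> T"
      using B(2)[OF i] i(1) by blast
  next
    fix T T' assume T: "T \<in> (\<Union>i\<in>I. B i) \<and> U \<in> T" "T' \<in> (\<Union>i\<in>I. B i) \<and> U \<in> T'"
    have "i = j" if "j \<in> I" "T \<in> B j" "U \<in> T" for j T
      using B(1)[OF that(1,2)] that i assms(2)
      unfolding disjoint_family_on_def by blast
    with T have "T \<in> B i" "T' \<in> B i"
      by blast+
    with B(2)[OF i] T show "T = T'"
      by blast
  qed
  moreover have "is_triangle T \<and> T \<subseteq> (\<Union>i\<in>I. L i)" if "T \<in> (\<Union>i\<in>I. B i)" for T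
    using that B(1) by fast
  ultimately show ?thesis
    unfolding triangulable_def by (intro exI[of _ "\<Union>i\<in>I. B i"]) simp
qed

lemma triangulable_UN_Diff:
  assumes "\<And>i. i \<in> I \<Longrightarrow> triangulable (L i)" and "disjoint_family_on L I" and "J \<subseteq> I"
  shows "triangulable ((\<Union>i\<in>I. L i) - (\<Union>i\<in>J. L i))"
proof -
  have "L i \<inter> L j = {}" if "i \<in> I - J" "j \<in> J" for i j
    using that assms(2,3) by (intro disjoint_family_onD[of L I]) auto
  then have "(\<Union>i\<in>I. L i) - (\<Union>i\<in>J. L i) = (\<Union>i\<in>I - J. L i)"
    by blast
  moreover have "triangulable (\<Union>i\<in>I - J. L i)"
  proof (rule triangulable_UN)
    show "disjoint_family_on L (I - J)"
      by (rule disjoint_family_on_mono[OF _ assms(2)]) auto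
  qed (use assms(1) in simp)
  ultimately show ?thesis
    by simp
qed

text \<open>Any map on lines cuts \<open>L\<close> into disjoint fibres that can be treated
  separately. It is used with \<open>h\<close> a projection or the span over F.\<close>

lemma triangulable_fibres:
  assumes "\<And>U. U \<in> L \<Longrightarrow> triangulable {U' \<in> L. h U' = h U}"
  shows "triangulable L"
proof -
  have "triangulable (\<Union>i\<in>h ` L. {U' \<in> L. h U' = i})"
  proof (rule triangulable_UN)
    show "triangulable {U' \<in> L. h U' = i}" if "i \<in> h ` L" for i
      using that assms by (elim imageE) simp
  qed (auto simp: disjoint_family_on_def)
  moreover have "(\<Union>i\<in>h ` L. {U' \<in> L. h U' = i}) = L"
    by auto
  ultimately show ?thesis
    by simp
qed

lemma triangulable_Un:
  assumes "triangulable L" and "triangulable M" and "L \<inter> M = {}"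
  shows "triangulable (L \<union> M)"
proof -
  have "triangulable (\<Union>b\<in>UNIV. if b then L else M)"
    by (rule triangulable_UN) (use assms in \<open>auto simp: disjoint_family_on_def\<close>)
  then show ?thesis
    by (simp add: UNIV_bool Un_commute)
qed

lemma triangulable_triangle:
  assumes "is_triangle T" shows "triangulable T"
  unfolding triangulable_def by (intro exI[of _ "{T}"]) (auto simp: assms)

text \<open>Tool for the mixed triangles: injective side maps with pairwise disjoint ranges make
  different triangles share no side.\<close>

lemma triangulable_family:
  assumes triangle: "\<And>i. i \<in> I \<Longrightarrow> is_triangle {f i, g i, h i}"
    and inj: "inj_on f I" "inj_on g I" "inj_on h I"
    and ne: "\<And>i j. i \<in> I \<Longrightarrow> j \<in> I \<Longrightarrow> f i \<noteq> g j \<and> f i \<noteq> h j \<and> g i \<noteq> h j"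
  shows "triangulable (f ` I \<union> g ` I \<union> h ` I)"
proof -
  have "disjoint_family_on (\<lambda>i. {f i, g i, h i}) I"
    unfolding disjoint_family_on_def
  proof (intro ballI impI)
    fix i j assume ij: "i \<in> I" "j \<in> I" "i \<noteq> j"
    then have "f i \<noteq> f j" "g i \<noteq> g j" "h i \<noteq> h j"
      by (simp_all add: inj[THEN inj_on_eq_iff])
    then show "{f i, g i, h i} \<inter> {f j, g j, h j} = {}"
      using ne[OF ij(1,2)] ne[OF ij(2,1)] by auto
  qed
  then have "triangulable (\<Union>i\<in>I. {f i, g i, h i})"
    by (rule triangulable_UN[rotated]) (rule triangulable_triangle[OF triangle])
  moreover have "(\<Union>i\<in>I. {f i, g i, h i}) = f ` I \<union> g ` I \<union> h ` I"
    by auto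
  ultimately show ?thesis
    by simp
qed

lemma image_line:
  assumes "\<And>x y. g (x + y) = g x + g y"
  shows "g ` line a b = line (g a) (g b)"
proof -
  have "g 0 = 0" using assms[of 0 0] by simp
  then show ?thesis by (simp add: line_def assms)
qed

text \<open>Additive injections carry triangles to triangles, so a partition found in
  \<open>F \<times> F\<close> can be copied into each plane of the vector space.\<close>

lemma triangulable_image:
  assumes "triangulable L" and "inj g" and add: "\<And>x y. g (x + y) = g x + g y"
  shows "triangulable ((`) g ` L)"
proof -
  obtain B where B: "\<forall>T\<in>B. is_triangle T \<and> T \<subseteq> L" "\<forall>U\<in>L. \<exists>!T. T \<in> B \<and> U \<in> T"
    using assms(1) unfolding triangulable_def by (elim exE conjE)
  have inj: "inj ((`) g)"
    by (intro injI) (simp add: inj_image_eq_iff[OF \<open>inj g\<close>])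
  have g0: "g x = 0 \<longleftrightarrow> x = 0" for x
    using add[of 0 0] inj_eq[OF \<open>inj g\<close>, of x 0] by simp
  have il: "line (g x) (g y) = g ` line x y" for x y
    by (rule image_line[of g, OF add, symmetric])
  have "is_triangle ((`) g ` T)" if T: "is_triangle T" for T
  proof -
    obtain a b c where *: "a \<noteq> 0" "b \<noteq> 0" "a \<noteq> b" "c \<notin> line a b" "T = {line a b, line b c, line c a}"
      using T unfolding is_triangle_def by blast
    then show ?thesis
      unfolding is_triangle_def
      by (intro exI[of _ "g a"] exI[of _ "g b"] exI[of _ "g c"])
        (simp add: g0 il inj_eq[OF \<open>inj g\<close>] inj_image_mem_iff[OF \<open>inj g\<close>])
  qed
  then have "is_triangle T \<and> T \<subseteq> (`) g ` L" if "T \<in> (`) ((`) g) ` B" for T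
    using that B(1) by (elim imageE) (simp add: image_mono)
  moreover have "\<exists>!T. T \<in> (`) ((`) g) ` B \<and> U \<in> T" if U: "U \<in> (`) g ` L" for U
  proof -
    obtain U' where U': "U = g ` U'" "U' \<in> L"
      using U by (elim imageE)
    have mem: "U \<in> (`) g ` T \<longleftrightarrow> U' \<in> T" for T
      unfolding U' by (rule inj_image_mem_iff[OF inj])
    obtain T where T: "T \<in> B" "U' \<in> T" "\<And>T'. T' \<in> B \<Longrightarrow> U' \<in> T' \<Longrightarrow> T' = T"
      using bspec[OF B(2) U'(2)] by blast
    show ?thesis
    proof (rule ex1I)
      show "(`) g ` T \<in> (`) ((`) g) ` B \<and> U \<in> (`) g ` T"
        using T(1,2) by (simp add: mem)
    next
      fix T' assume "T' \<in> (`) ((`) g) ` B \<and> U \<in> T'"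
      then obtain T'' where T'': "T' = (`) g ` T''" "T'' \<in> B" "U \<in> T'"
        by blast
      then have "T'' = T"
        by (intro T(3)) (simp_all add: mem)
      with T'' show "T' = (`) g ` T"
        by simp
    qed
  qed
  ultimately show ?thesis
    unfolding triangulable_def by (intro exI[of _ "(`) ((`) g) ` B"]) simp
qed

section \<open>Lines in characteristic two\<close>

locale char_two =
  fixes ty :: "'a::ab_group_add itself"
  assumes add_self: "\<And>x::'a. x + x = 0"
begin

lemma add_self_left: "x + (x + y) = (y::'a)"
  by (simp add: add_self flip: add.assoc)

lemma uminus_eq: "- x = (x::'a)"
  by (rule minus_unique[OF add_self])

lemma diff_eq: "x - y = x + (y::'a)"
  by (simp only: diff_conv_add_uminus uminus_eq)

lemma add_eq_0: "x + y = 0 \<longleftrightarrow> x = (y::'a)"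
  using add_self[of x] by (metis add_left_cancel)

lemmas two_simps = add_self add_self_left uminus_eq diff_eq add_eq_0

lemma line_rotate: "line b (a + b) = line a (b::'a)"
proof -
  have "b + (a + b) = a"
    by (metis add.left_commute add_self add.right_neutral)
  then show ?thesis
    unfolding line_def by (simp only: insert_commute)
qed

lemma line_eqI:
  fixes a b :: 'a
  assumes "a \<in> line c d" "b \<in> line c d" "a \<noteq> 0" "b \<noteq> 0" "a \<noteq> b"
  shows "line a b = line c d"
proof -
  have "line d (c + d) = line c d" "line (c + d) d = line c d"
    "line c (c + d) = line c d" "line (c + d) c = line c d" "line d c = line c d"
    using line_rotate[of d c] line_rotate[of c d] by (simp_all add: line_commute add.commute)
  moreover have "a \<in> {0, c, d, c + d}" "b \<in> {0, c, d, c + d}"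
    using assms(1,2) by (simp_all only: line_def)
  ultimately show ?thesis
    using assms(3-5) by (elim insertE emptyE) simp_all
qed

text \<open>Among three distinct nonzero vectors the only possible relation is
  \<open>c = a + b\<close>, and it would make the sides coincide.\<close>

lemma is_triangleI:
  fixes a b c :: 'a
  assumes "a \<noteq> 0" "b \<noteq> 0" "c \<noteq> 0" "a \<noteq> b" "b \<noteq> c" "c \<noteq> a" "line a b \<noteq> line b c"
  shows "is_triangle {line a b, line b c, line c a}"
proof -
  have "c \<noteq> a + b"
  proof
    assume "c = a + b"
    then have "line b c = line a b"
      using assms by (intro line_eqI) (auto simp: line_def)
    with assms show False by simp
  qed
  with assms show ?thesis
    unfolding is_triangle_def
    by (intro exI[of _ a] exI[of _ b] exI[of _ c]) (simp add: line_def)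
qed

end

section \<open>The field with 64 elements\<close>

locale field_64 =
  fixes ty :: "'f::{field,finite} itself"
  assumes card_64: "card (UNIV :: 'f set) = 2 ^ 6"
begin

text \<open>Translation by 1 permutes the field, so summing over all its elements shows that
  \<open>2 ^ 6\<close> vanishes in it.\<close>

lemma two_eq_0: "(2::'f) = 0"
proof -
  have "(\<Sum>x\<in>UNIV. x + (1::'f)) = (\<Sum>x\<in>UNIV. x)"
    by (rule sum.reindex_bij_witness[of _ "\<lambda>x. x - 1" "\<lambda>x. x + 1"]) auto
  then have "of_nat (card (UNIV :: 'f set)) = (0::'f)"
    by (simp add: sum.distrib)
  then have "(2::'f) ^ 6 = 0"
    by (simp add: card_64)
  then show ?thesis
    unfolding power_eq_0_iff by simp
qed

sublocale char_two ty
  by standard (simp flip: mult_2 add: two_eq_0)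

sublocale pair: char_two "TYPE('f \<times> 'f)"
  by standard (simp add: plus_prod_def zero_prod_def two_simps)

text \<open>Multiplication by \<open>x\<close> permutes the 63 nonzero elements and so preserves
  their product.\<close>

lemma power_63: "x ^ 63 = 1" if "x \<noteq> 0" for x :: 'f
proof -
  have "(\<Prod>y\<in>-{0}. x * y) = (\<Prod>y\<in>-{0::'f}. y)"
    using that by (intro prod.reindex_bij_witness[of _ "\<lambda>y. y / x" "\<lambda>y. x * y"]) auto
  moreover have "card (- {0::'f}) = 63"
    by (simp add: card_64 Compl_eq_Diff_UNIV)
  ultimately have "x ^ 63 * (\<Prod>y\<in>-{0::'f}. y) = (\<Prod>y\<in>-{0::'f}. y)"
    by (simp add: prod.distrib)
  then show ?thesis by simp
qed

text \<open>The polynomial \<open>X ^ n - 1\<close> has at most \<open>n\<close> roots, too few for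
  63 nonzero elements.\<close>

lemma exists_power_neq_1:
  assumes "0 < n" "n < 63"
  shows "\<exists>x::'f. x \<noteq> 0 \<and> x ^ n \<noteq> 1"
proof (rule ccontr)
  assume *: "\<not> ?thesis"
  define p where "p = monom (1::'f) n - 1"
  have "coeff p n = 1"
    using assms by (simp add: p_def)
  then have "p \<noteq> 0" by auto
  have "card (-{0::'f}) \<le> card {x. poly p x = 0}"
    using * by (intro card_mono) (auto simp: p_def poly_monom)
  also have "\<dots> \<le> degree p"
    using \<open>p \<noteq> 0\<close> by (rule card_poly_roots_bound)
  also have "\<dots> \<le> n"
    unfolding p_def by (intro degree_diff_le) (auto simp: degree_monom_le)
  finally show False
    using assms by (simp add: card_64 Compl_eq_Diff_UNIV)
qed


lemma add_power2: "(x + y) ^ 2 = x ^ 2 + (y::'f) ^ 2"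
  by (simp add: power2_sum two_eq_0)

lemma add_power4: "(x + y) ^ 4 = x ^ 4 + (y::'f) ^ 4"
  using add_power2[of "x ^ 2" "y ^ 2"] by (simp flip: add_power2 power_mult)

lemma add_power16: "(x + y) ^ 16 = x ^ 16 + (y::'f) ^ 16"
  using add_power4[of "x ^ 4" "y ^ 4"] by (simp flip: add_power4 power_mult)

text \<open>Write 21 = 16 + 4 + 1; the powers 4 and 16 are additive.\<close>

lemma one_plus_power_21: "(1 + x) ^ 21 = (1 + x ^ 16) * (1 + x ^ 4) * (1 + (x::'f))"
proof -
  have "(1 + x) ^ 21 = (1 + x) ^ 16 * (1 + x) ^ 4 * (1 + x)"
    by (simp flip: power_add power_Suc2)
  then show ?thesis
    by (simp add: add_power4 add_power16)
qed

text \<open>This is the ninth cyclotomic polynomial. If \<open>x ^ 21 \<noteq> 1\<close>, then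
  \<open>z = x ^ 7\<close> satisfies \<open>z ^ 9 = 1\<close> and
  \<open>z ^ 3 \<noteq> 1\<close>.\<close>

lemma exists_root: "\<exists>z::'f. z ^ 6 + z ^ 3 + 1 = 0"
proof -
  obtain x :: 'f where x: "x \<noteq> 0" "x ^ 21 \<noteq> 1"
    using exists_power_neq_1[of 21] by auto
  have "(x ^ 21 - 1) * ((x ^ 7) ^ 6 + (x ^ 7) ^ 3 + 1) = x ^ 63 - 1"
    by (simp add: algebra_simps flip: power_mult power_add)
  then have "(x ^ 7) ^ 6 + (x ^ 7) ^ 3 + 1 = 0"
    using x power_63[of x] by simp
  then show ?thesis ..
qed

lemma line_in_add: "line b c = line (b + c) (b :: 'f \<times> 'f)"
  using pair.line_rotate[of b "b + c"] by (simp add: pair.add_self_left add.assoc add.commute)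

section \<open>Lines that span the plane \<open>F \<times> F\<close>\<close>

definition det :: "'f \<times> 'f \<Rightarrow> 'f \<times> 'f \<Rightarrow> 'f"
  where "det a b = fst a * snd b + fst b * snd a"

lemma det_simps:
  "det a (b + c) = det a b + det a c" "det (a + b) c = det a c + det b c"
  "det a a = 0" "det a 0 = 0" "det 0 a = 0"
  by (simp_all add: det_def algebra_simps add_self)

lemma det_commute: "det a b = det b a"
  by (simp add: det_def add.commute)

text \<open>In characteristic 2 the determinant is symmetric, and it does not change when one
  argument is added to the other.\<close>

lemma det_line:
  assumes "x \<in> line a b" "y \<in> line a b" "x \<noteq> 0" "y \<noteq> 0" "x \<noteq> y"
  shows "det x y = det a b"
  using assms unfolding line_def
  by (elim insertE emptyE) (simp_all add: det_simps det_commute[of b a])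

text \<open>The lines contained in no one-dimensional F-subspace, as \<open>det\<close> vanishes
  exactly on pairs dependent over F.\<close>

definition lines :: "('f \<times> 'f) set set"
  where "lines = {line a b |a b. det a b \<noteq> 0}"

lemma det_neq_0D: "det a b \<noteq> 0 \<Longrightarrow> a \<noteq> 0 \<and> b \<noteq> 0 \<and> a \<noteq> b"
  by (auto simp: det_simps)

lemma line_in_lines_iff: "line a b \<in> lines \<longleftrightarrow> det a b \<noteq> 0"
proof
  assume "line a b \<in> lines"
  then obtain c d where cd: "line a b = line c d" "det c d \<noteq> 0"
    unfolding lines_def by blast
  have "c \<in> line a b" "d \<in> line a b"
    unfolding cd(1) by (simp_all add: line_def)
  with det_line[OF this] det_neq_0D[OF cd(2)] cd(2) show "det a b \<noteq> 0"
    by simp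
qed (unfold lines_def, blast)

lemma lines_eqI:
  assumes "U \<in> lines" "a \<in> U" "b \<in> U" "a \<noteq> 0" "b \<noteq> 0" "a \<noteq> b"
  shows "U = line a b"
proof -
  obtain c d where "U = line c d"
    using assms(1) unfolding lines_def by blast
  with assms show ?thesis
    using pair.line_eqI[of a c d b] by simp
qed

lemma fst_line: "fst ` line a b = line (fst a) (fst b)"
  and snd_line: "snd ` line a b = line (snd a) (snd b)"
  by (rule image_line, simp)+

lemma zero_pair_eq: "(0 :: 'f \<times> 'f) = (0, 0)"
  by (simp add: zero_prod_def)

text \<open>Slopes are convenient because the determinant of the two points is
  \<open>x * y * (p + r)\<close>: for nonzero \<open>x\<close>, \<open>y\<close> the line belongs to
  \<open>lines\<close> exactly when \<open>p \<noteq> r\<close>.\<close>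

definition slope_line :: "'f \<Rightarrow> 'f \<Rightarrow> 'f \<Rightarrow> 'f \<Rightarrow> ('f \<times> 'f) set"
  where "slope_line x y p r = line (x, x * p) (y, y * r)"

text \<open>
  The image of a triangle with vertices of slope \<open>p, r, s\<close> over \<open>x, y, x + y\<close> under \<open>m \<mapsto> c m + t\<close>
  acting on slopes; \<open>base_slopes\<close> are the pairs of slopes over \<open>x, y\<close> of its three sides for \<open>c = 1, t = 0\<close>.
\<close>

definition orbit_triangle :: "'f \<Rightarrow> 'f \<Rightarrow> 'f \<Rightarrow> 'f \<Rightarrow> 'f \<Rightarrow> 'f \<Rightarrow> 'f \<Rightarrow> ('f \<times> 'f) set set"
  where "orbit_triangle x y p r s c t =
    (let a = (x, x * (c * p + t)); b = (y, y * (c * r + t)); d = (x + y, (x + y) * (c * s + t))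
     in {line a b, line b d, line d a})"

definition base_slopes :: "'f \<Rightarrow> 'f \<Rightarrow> 'f \<Rightarrow> 'f \<Rightarrow> 'f \<Rightarrow> ('f \<times> 'f) set"
  where "base_slopes x y p r s =
    {(p, r), ((y * r + (x + y) * s) / x, r), (p, (x * p + (x + y) * s) / y)}"

context
  fixes x y :: 'f
  assumes xy: "x \<noteq> 0" "y \<noteq> 0" "x \<noteq> y"
begin

lemma slope_line_inject: "slope_line x y p r = slope_line x y p' r' \<longleftrightarrow> p = p' \<and> r = r'"
proof
  assume *: "slope_line x y p r = slope_line x y p' r'"
  have "(x, x * p) \<in> slope_line x y p' r'" "(y, y * r) \<in> slope_line x y p' r'"
    unfolding *[symmetric] by (simp_all add: slope_line_def line_def)
  then show "p = p' \<and> r = r'"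
    using xy by (simp add: slope_line_def line_def zero_pair_eq)
qed simp

lemma lines_over: "{U \<in> lines. fst ` U = line x y} = {slope_line x y p r |p r. p \<noteq> r}"
proof (intro equalityI subsetI)
  fix U assume "U \<in> {U \<in> lines. fst ` U = line x y}"
  then have U: "U \<in> lines" and "x \<in> fst ` U" "y \<in> fst ` U"
    by (simp_all add: line_def)
  then obtain p' r' where "(x, p') \<in> U" "(y, r') \<in> U"
    by auto
  then have "U = line (x, p') (y, r')"
    using U xy by (intro lines_eqI) (auto simp: zero_pair_eq)
  then have *: "U = slope_line x y (p' / x) (r' / y)"
    using xy by (simp add: slope_line_def)
  with U have "p' / x \<noteq> r' / y"
    using xy by (auto simp: slope_line_def line_in_lines_iff det_def add_eq_0 frac_eq_eq mult.commute)
  with * show "U \<in> {slope_line x y p r |p r. p \<noteq> r}"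
    by blast
next
  fix U assume "U \<in> {slope_line x y p r |p r. p \<noteq> r}"
  then obtain p r where "U = slope_line x y p r" "p \<noteq> r"
    by blast
  then show "U \<in> {U \<in> lines. fst ` U = line x y}"
    using xy by (auto simp: slope_line_def line_in_lines_iff det_def fst_line add_eq_0)
qed

text \<open>The slope of a sum of two vertices is a weighted mean of their slopes, the weights, such
  as \<open>y / x\<close> and \<open>(x + y) / x\<close>, adding up to 1. Hence it commutes with
  every map \<open>m \<mapsto> c m + t\<close>.\<close>

lemma orbit_triangle_slopes:
  "orbit_triangle x y p r s c t =
    (\<lambda>q. slope_line x y (c * fst q + t) (c * snd q + t)) ` base_slopes x y p r s"
proof -
  let ?a = "(x, x * (c * p + t))" and ?b = "(y, y * (c * r + t))"
    and ?d = "(x + y, (x + y) * (c * s + t))"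
  have "line ?b ?d = line (?b + ?d) ?b"
    by (rule line_in_add)
  also have "?b + ?d = (x, x * (c * ((y * r + (x + y) * s) / x) + t))"
    using xy by (simp add: field_simps add_self add_self_left)
  finally have 1: "line ?b ?d = slope_line x y (c * ((y * r + (x + y) * s) / x) + t) (c * r + t)"
    by (simp add: slope_line_def)
  have "line ?d ?a = line ?a (?a + ?d)"
    using line_in_add[of ?a ?d] by (simp only: line_commute)
  also have "?a + ?d = (y, y * (c * ((x * p + (x + y) * s) / y) + t))"
    using xy by (simp add: field_simps add_self add_self_left)
  finally have 2: "line ?d ?a = slope_line x y (c * p + t) (c * ((x * p + (x + y) * s) / y) + t)"
    by (simp add: slope_line_def)
  show ?thesis
    by (simp add: orbit_triangle_def base_slopes_def Let_def 1 2) (simp add: slope_line_def)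
qed

end

end

section \<open>Ninth and third roots of unity\<close>

text \<open>The equation says that \<open>\<zeta>\<close> is a primitive ninth root of unity.\<close>

locale field_64_root = field_64 ty for ty :: "'f::{field,finite} itself" +
  fixes \<zeta> \<omega> :: 'f
  assumes root: "\<zeta> ^ 6 + \<zeta> ^ 3 + 1 = 0"
    and \<omega>: "\<omega> = \<zeta> ^ 3"
begin

lemma omega_sum: "\<omega> ^ 2 + \<omega> + 1 = 0"
  using root by (simp add: \<omega> flip: power_mult)

lemma omega_root: "\<omega> ^ 2 = \<omega> + 1"
  using omega_sum by (simp add: add_eq_0 add.assoc)

lemma omega_neq: "\<omega> \<noteq> 0" "\<omega> \<noteq> 1" "\<omega> + 1 \<noteq> 0" "\<omega> ^ 2 \<noteq> 1" "\<omega> ^ 2 \<noteq> \<omega>"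
  using omega_root by (auto simp: two_simps)

lemma omega_mult: "\<omega> * \<omega> = \<omega> ^ 2" "\<omega> * \<omega> ^ 2 = 1" "\<omega> ^ 2 * \<omega> = 1" "\<omega> ^ 2 * \<omega> ^ 2 = \<omega>"
  by (insert omega_sum) algebra+

lemma omega_4: "\<omega> ^ 4 = \<omega>"
  using omega_sum by algebra

lemma omega_inverse: "inverse \<omega> = \<omega> ^ 2" "inverse (\<omega> ^ 2) = \<omega>"
  using omega_mult(2,3) by (simp_all only: inverse_unique)

lemma zeta_9: "\<zeta> ^ 9 = 1"
  using omega_mult(2) unfolding \<omega> by (simp flip: power_mult power_add)

lemma zeta_neq: "\<zeta> \<noteq> 0" "1 + \<zeta> \<noteq> 0" "\<zeta> \<noteq> 1" "\<zeta> \<noteq> 1 + \<zeta>"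
proof -
  show "\<zeta> \<noteq> 0" "\<zeta> \<noteq> 1"
    using omega_neq \<omega> by auto
  then show "1 + \<zeta> \<noteq> 0" "\<zeta> \<noteq> 1 + \<zeta>"
    by (auto simp: add_eq_0)
qed

lemma zeta_sum: "\<zeta> ^ 2 + \<zeta> + 1 \<noteq> 0"
proof
  assume "\<zeta> ^ 2 + \<zeta> + 1 = 0"
  moreover have "\<zeta> ^ 3 = \<zeta> * (\<zeta> ^ 2 + \<zeta> + 1) - (\<zeta> ^ 2 + \<zeta> + 1) + 1"
    by (simp add: algebra_simps power2_eq_square power3_eq_cube)
  ultimately show False
    using omega_neq(2) \<omega> by simp
qed

lemma chi_zeta: "\<zeta> ^ 21 = \<omega>"
proof -
  have "\<zeta> ^ 21 = \<zeta> ^ 9 * \<zeta> ^ 9 * \<zeta> ^ 3"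
    by (simp flip: power_add)
  then show ?thesis
    by (simp add: zeta_9 \<omega>)
qed

lemma chi_zeta_1: "(1 + \<zeta>) ^ 21 = \<omega> ^ 2"
proof -
  have "\<zeta> ^ 16 = \<zeta> ^ 9 * \<zeta> ^ 7"
    by (simp flip: power_add)
  then have "(1 + \<zeta>) ^ 21 = (1 + \<zeta> ^ 7) * (1 + \<zeta> ^ 4) * (1 + \<zeta>)"
    by (simp add: one_plus_power_21 zeta_9)
  \<comment> \<open>The nine ninth roots of unity sum to 0, and the expanded product contains each
    of them once except \<open>\<zeta> ^ 6\<close>.\<close>
  also have "\<dots> = - (\<zeta> ^ 6)"
    using root by algebra
  also have "\<dots> = \<omega> ^ 2"
    by (simp add: \<omega> uminus_eq flip: power_mult)
  finally show ?thesis .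
qed

section \<open>The cubic character and the cyclotomic numbers\<close>

lemma chi_cases:
  fixes x :: 'f
  assumes "x \<noteq> 0"
  shows "x ^ 21 = 1 \<or> x ^ 21 = \<omega> \<or> x ^ 21 = \<omega> ^ 2"
proof -
  define t where "t = x ^ 21"
  have "t ^ 3 = 1"
    using power_63[OF assms] by (simp add: t_def flip: power_mult)
  then have "(t - 1) * (t - \<omega>) * (t - \<omega> ^ 2) = 0"
    using omega_sum by algebra
  then show ?thesis
    by (simp add: t_def)
qed

text \<open>The cyclotomic numbers of order 3 count the witnesses \<open>s\<close> below.\<close>

definition cell :: "'f \<Rightarrow> 'f \<Rightarrow> bool"
  where "cell i j \<longleftrightarrow> (\<exists>s. s \<noteq> 0 \<and> 1 + s \<noteq> 0 \<and> s ^ 21 = i \<and> (1 + s) ^ 21 = j)"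

text \<open>Replace \<open>s\<close> by \<open>1 + s\<close>; the next two lemmas replace it by its
  square and by its inverse. These symmetries spread nonemptiness from few cells to the
  others.\<close>

lemma cell_swap: "cell i j \<Longrightarrow> cell j i"
  unfolding cell_def by (metis add_self_left)

lemma cell_square: "cell i j \<Longrightarrow> cell (i ^ 2) (j ^ 2)"
  unfolding cell_def
proof (elim exE conjE)
  fix s :: 'f assume "s \<noteq> 0" "1 + s \<noteq> 0" "s ^ 21 = i" "(1 + s) ^ 21 = j"
  moreover have "1 + s ^ 2 = (1 + s) ^ 2"
    by (simp add: add_power2)
  ultimately show "\<exists>s. s \<noteq> 0 \<and> 1 + s \<noteq> 0 \<and> s ^ 21 = i ^ 2 \<and> (1 + s) ^ 21 = j ^ 2"
    by (intro exI[of _ "s ^ 2"]) (auto simp flip: power_mult simp: mult.commute)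
qed

lemma cell_inverse: "cell i j \<Longrightarrow> cell (inverse i) (j * inverse i)"
  unfolding cell_def
proof (elim exE conjE)
  fix s :: 'f assume s: "s \<noteq> 0" "1 + s \<noteq> 0" "s ^ 21 = i" "(1 + s) ^ 21 = j"
  moreover have "1 + inverse s = (1 + s) * inverse s"
    using s by (simp add: field_simps)
  ultimately show "\<exists>s. s \<noteq> 0 \<and> 1 + s \<noteq> 0 \<and> s ^ 21 = inverse i \<and> (1 + s) ^ 21 = j * inverse i"
    by (intro exI[of _ "inverse s"]) (auto simp: power_mult_distrib power_inverse)
qed

text \<open>The witness is \<open>\<omega> * u\<close> with \<open>u\<close> of order 7, an element
  of GF(8). The character of \<open>1 + s\<close> is then
  \<open>\<omega> * Tr u + \<omega> ^ 2 * Tr (u ^ 3)\<close>, with the trace from GF(8) to F_2, and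
  exactly one of the two traces is 1.\<close>

lemma cell_1: "cell 1 \<omega> \<or> cell 1 (\<omega> ^ 2)"
proof -
  obtain y :: 'f where y: "y \<noteq> 0" "y ^ 9 \<noteq> 1"
    using exists_power_neq_1[of 9] by auto
  define u where "u = y ^ 9"
  have u7: "u ^ 7 = 1"
    using power_63[OF y(1)] by (simp add: u_def flip: power_mult)
  have "u \<noteq> 1" "u \<noteq> 0"
    using y by (auto simp: u_def)
  \<comment> \<open>Modulo 2 the seventh cyclotomic polynomial is the product of these two cubics;
    the right-hand side is the error over the integers.\<close>
  have "(u - 1) * ((u ^ 3 + u + 1) * (u ^ 3 + u ^ 2 + 1)) = 2 * (u ^ 3 * (u - 1))"
    using u7 by algebra
  then have "(u - 1) * ((u ^ 3 + u + 1) * (u ^ 3 + u ^ 2 + 1)) = 0"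
    by (simp add: two_eq_0)
  then have u: "u ^ 3 + u + 1 = 0 \<or> u ^ 3 + u ^ 2 + 1 = 0"
    using \<open>u \<noteq> 1\<close> by simp
  define s where "s = \<omega> * u"
  have chi_s: "s ^ 21 = 1"
  proof -
    have "s ^ 21 = (\<omega> * \<omega> ^ 2) ^ 7 * (u ^ 7) ^ 3"
      by (simp add: s_def power_mult_distrib flip: power_mult power_Suc power_add)
    then show ?thesis
      by (simp add: omega_mult u7)
  qed
  have "s ^ 16 = \<omega> * u ^ 2" "s ^ 4 = \<omega> * u ^ 4"
    unfolding s_def using u7 omega_sum by algebra+
  then have "(1 + s) ^ 21 = (1 + \<omega> * u ^ 2) * (1 + \<omega> * u ^ 4) * (1 + \<omega> * u)"
    by (simp add: one_plus_power_21 s_def)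
  also have "\<dots> = \<omega> * (u + u ^ 2 + u ^ 4) + \<omega> ^ 2 * (u ^ 3 + u ^ 5 + u ^ 6) + 2"
    using u7 omega_sum by algebra
  finally have eq: "(1 + s) ^ 21 = \<omega> * (u + u ^ 2 + u ^ 4) + \<omega> ^ 2 * (u ^ 3 + u ^ 5 + u ^ 6)"
    by (simp add: two_eq_0)
  have "(1 + s) ^ 21 = \<omega> \<or> (1 + s) ^ 21 = \<omega> ^ 2"
    using u
  proof
    assume "u ^ 3 + u + 1 = 0"
    then have "u + u ^ 2 + u ^ 4 = 0" "u ^ 3 + u ^ 5 + u ^ 6 = 2 * u + 1"
      by algebra+
    then show ?thesis
      unfolding eq by (simp add: two_eq_0)
  next
    assume "u ^ 3 + u ^ 2 + 1 = 0"
    then have "u + u ^ 2 + u ^ 4 = 2 * u ^ 2 + 1" "u ^ 3 + u ^ 5 + u ^ 6 = 0"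
      by algebra+
    then show ?thesis
      unfolding eq by (simp add: two_eq_0)
  qed
  moreover from this have "1 + s \<noteq> 0"
    using omega_neq(1) by (auto simp: zero_power)
  moreover have "s \<noteq> 0"
    using \<open>u \<noteq> 0\<close> omega_neq(1) by (simp add: s_def)
  ultimately show ?thesis
    unfolding cell_def using chi_s by auto
qed

text \<open>The element \<zeta> witnesses the pair \<open>\<omega>\<close>,
  \<open>\<omega> ^ 2\<close>. One cell with first entry 1 comes from \<open>cell_1\<close>, the
  other by squaring, and the two diagonal ones by inversion.\<close>

lemma cell_nonempty:
  assumes "i \<in> {1, \<omega>, \<omega> ^ 2}" "j \<in> {1, \<omega>, \<omega> ^ 2}" "i \<noteq> 1 \<or> j \<noteq> 1"
  shows "cell i j"
proof -
  have "cell \<omega> (\<omega> ^ 2)"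
    unfolding cell_def using zeta_neq chi_zeta chi_zeta_1 by blast
  moreover have c1: "cell 1 \<omega>" "cell 1 (\<omega> ^ 2)"
    using cell_1 cell_square[of 1 \<omega>] cell_square[of 1 "\<omega> ^ 2"]
    by (auto simp: omega_4)
  moreover have "cell (\<omega> ^ 2) (\<omega> ^ 2)" "cell \<omega> \<omega>"
    using c1[THEN cell_swap, THEN cell_inverse] by (simp_all add: omega_inverse)
  ultimately show ?thesis
    using assms by (auto intro: cell_swap)
qed

text \<open>Aim at the classes \<open>p\<close> and \<open>p ^ 2\<close> with
  \<open>p = \<omega>\<close> or \<open>p = \<omega> ^ 2\<close>. Each choice prescribes a cell, and
  at most one of the two cells is the excluded \<open>(1, 1)\<close>.\<close>

lemma exists_distinct_classes:
  assumes "A \<noteq> 0" "B \<noteq> (0::'f)"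
  obtains s where "s \<noteq> 0" "1 + s \<noteq> 0" "(A * s) ^ 21 \<noteq> 1" "(B * (1 + s)) ^ 21 \<noteq> 1"
    "(A * s) ^ 21 \<noteq> (B * (1 + s)) ^ 21"
proof -
  let ?M = "{1, \<omega>, \<omega> ^ 2}"
  have "inverse (x ^ 21) \<in> ?M" if "x \<noteq> 0" for x :: 'f
    using chi_cases[OF that] by (elim disjE) (simp_all add: omega_inverse)
  then have inv: "inverse (A ^ 21) \<in> ?M" "inverse (B ^ 21) \<in> ?M"
    using assms by blast+
  have mult: "x * y \<in> ?M" if "x \<in> ?M" "y \<in> ?M" for x y
    using that by (auto simp: omega_mult omega_4)
  have "\<exists>p\<in>{\<omega>, \<omega> ^ 2}. cell (p * inverse (A ^ 21)) (p ^ 2 * inverse (B ^ 21))"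
  proof (cases "\<omega> * inverse (A ^ 21) = 1 \<and> \<omega> ^ 2 * inverse (B ^ 21) = 1")
    case True
    then have "\<omega> ^ 2 * inverse (A ^ 21) = \<omega>"
      by (metis mult.assoc mult.right_neutral power2_eq_square)
    then have "cell (\<omega> ^ 2 * inverse (A ^ 21)) ((\<omega> ^ 2) ^ 2 * inverse (B ^ 21))"
      using inv by (intro cell_nonempty mult) (auto simp: omega_4 omega_neq)
    then show ?thesis by blast
  next
    case False
    then have "cell (\<omega> * inverse (A ^ 21)) (\<omega> ^ 2 * inverse (B ^ 21))"
      using inv by (intro cell_nonempty mult) auto
    then show ?thesis by blast
  qed
  then obtain p s where p: "p \<in> {\<omega>, \<omega> ^ 2}" and s: "s \<noteq> 0" "1 + s \<noteq> 0"
      "s ^ 21 = p * inverse (A ^ 21)" "(1 + s) ^ 21 = p ^ 2 * inverse (B ^ 21)"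
    unfolding cell_def by blast
  have "(A * s) ^ 21 = p" "(B * (1 + s)) ^ 21 = p ^ 2"
    using assms s by (simp_all add: power_mult_distrib)
  moreover have "p \<noteq> 1" "p ^ 2 \<noteq> 1" "p \<noteq> p ^ 2"
    using p omega_neq by (auto simp: omega_4)
  ultimately show thesis
    using that s(1,2) by simp
qed

section \<open>Lines projecting onto a line of the field\<close>

text \<open>The nonzero cubes, described as the kernel of the cubic character.\<close>

definition cubes :: "'f set"
  where "cubes = {c. c ^ 21 = 1}"

lemma cubes_nonzero: "c \<in> cubes \<Longrightarrow> c \<noteq> 0"
  by (auto simp: cubes_def)

text \<open>\<open>Q\<close> contains exactly one representative of each orbit of pairs of distinct
  slopes under the maps \<open>m \<mapsto> c m + t\<close> with \<open>c\<close> a nonzero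
  cube.\<close>

definition class_system :: "('f \<times> 'f) set \<Rightarrow> bool"
  where "class_system Q \<longleftrightarrow> bij_betw (\<lambda>q. (fst q + snd q) ^ 21) Q {1, \<omega>, \<omega> ^ 2}"

lemma class_system_triple:
  assumes "(p\<^sub>1 + q\<^sub>1) ^ 21 = i" "(p\<^sub>2 + q\<^sub>2) ^ 21 = j" "(p\<^sub>3 + q\<^sub>3) ^ 21 = k"
    and "{i, j, k} = {1, \<omega>, \<omega> ^ 2}"
  shows "class_system {(p\<^sub>1, q\<^sub>1), (p\<^sub>2, q\<^sub>2), (p\<^sub>3, q\<^sub>3)}"
proof -
  have "card {i, j, k} = 3"
    using assms(4) omega_neq by simp
  then have "i \<noteq> j" "j \<noteq> k" "k \<noteq> i"
    by (auto simp: card_insert_if split: if_splits)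
  then show ?thesis
    using assms unfolding class_system_def bij_betw_def by auto
qed

lemma class_system_nonzero: "class_system Q \<Longrightarrow> q \<in> Q \<Longrightarrow> fst q + snd q \<noteq> 0"
  unfolding class_system_def
  using omega_neq bij_betwE[of "\<lambda>q. (fst q + snd q) ^ 21" Q "{1, \<omega>, \<omega> ^ 2}"]
  by (metis (no_types, lifting) emptyE insertE zero_neq_one zero_power2 power_0_left power_eq_0_iff zero_neq_numeral)

text \<open>For two pairs in the same class the quotient of the differences is a cube; this is
  \<open>c\<close>, and \<open>t\<close> then adjusts the first slope.\<close>

lemma class_system_exists:
  assumes "class_system Q" "p \<noteq> r"
  obtains c t q where "c \<in> cubes" "q \<in> Q" "p = c * fst q + t" "r = c * snd q + t"
proof -
  have "p + r \<noteq> 0"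
    using assms(2) by (simp add: add_eq_0)
  from chi_cases[OF this] obtain q where q: "q \<in> Q" "(fst q + snd q) ^ 21 = (p + r) ^ 21"
    using bij_betw_imp_surj_on[OF assms(1)[unfolded class_system_def]]
    by (metis (no_types, lifting) imageE insertCI)
  define c where "c = (p + r) / (fst q + snd q)"
  have nz: "fst q + snd q \<noteq> 0"
    using assms(1) q(1) by (rule class_system_nonzero)
  have "c ^ 21 = 1"
    using q(2) nz \<open>p + r \<noteq> 0\<close> by (simp add: c_def power_divide)
  moreover have "r = c * snd q + (p + c * fst q)"
  proof -
    have "c * snd q + (p + c * fst q) = c * (fst q + snd q) + p"
      by (simp add: algebra_simps)
    also have "\<dots> = r + (p + p)"
      using nz by (simp add: c_def add.commute add.left_commute)
    finally show ?thesis
      by (simp add: add_self)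
  qed
  ultimately show thesis
    using q(1) that[of c q "p + c * fst q"]
    by (simp add: cubes_def add_self add_self_left add.left_commute)
qed

text \<open>Adding the two equations removes \<open>t\<close> and \<open>t'\<close>; the cubic
  character then identifies \<open>q\<close> with \<open>q'\<close>, and the rest is
  cancellation.\<close>

lemma class_system_unique:
  assumes "class_system Q" "c \<in> cubes" "c' \<in> cubes" "q \<in> Q" "q' \<in> Q"
    and eq: "c * fst q + t = c' * fst q' + t'" "c * snd q + t = c' * snd q' + t'"
  shows "c = c' \<and> t = t'"
proof -
  have "(c * fst q + t) + (c * snd q + t) = (c' * fst q' + t') + (c' * snd q' + t')"
    by (simp only: eq)
  moreover have "(e * f + u) + (e * g + u) = e * (f + g)" for e f g u :: 'f
  proof -
    have "(e * f + u) + (e * g + u) = e * (f + g) + (u + u)"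
      by (simp add: algebra_simps)
    then show ?thesis
      by (simp add: add_self)
  qed
  ultimately have *: "c * (fst q + snd q) = c' * (fst q' + snd q')"
    by simp
  then have "(c * (fst q + snd q)) ^ 21 = (c' * (fst q' + snd q')) ^ 21"
    by simp
  then have "(fst q + snd q) ^ 21 = (fst q' + snd q') ^ 21"
    using assms(2,3) by (simp add: power_mult_distrib cubes_def)
  then have "q = q'"
    using assms(1,4,5) unfolding class_system_def bij_betw_def inj_on_def by blast
  with * have "c = c'"
    using class_system_nonzero[OF assms(1,4)] by simp
  with eq \<open>q = q'\<close> show ?thesis
    by simp
qed

text \<open>By \<open>class_system_exists\<close> and \<open>class_system_unique\<close> each line
  over \<open>line x y\<close> lies in exactly one triangle of the orbit. \<open>S\<close> lists the
  translations whose triangles are withheld.\<close>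

lemma triangulable_over_line:
  assumes xy: "x \<noteq> 0" "y \<noteq> 0" "x \<noteq> y"
    and Q: "class_system (base_slopes x y p r s)"
  shows "triangulable ({U \<in> lines. fst ` U = line x y} - (\<Union>c\<in>cubes. \<Union>t\<in>S. orbit_triangle x y p r s c t))"
proof -
  let ?T = "\<lambda>i. orbit_triangle x y p r s (fst i) (snd i)"
  let ?N = "slope_line x y"
  note inject = slope_line_inject[OF xy] and slopes = orbit_triangle_slopes[OF xy]
  have disj: "disjoint_family_on ?T (cubes \<times> UNIV)"
    unfolding disjoint_family_on_def
  proof (intro ballI impI, rule ccontr)
    fix i j assume ij: "i \<in> cubes \<times> UNIV" "j \<in> cubes \<times> UNIV" "i \<noteq> j" "?T i \<inter> ?T j \<noteq> {}"
    then obtain q q' where "q \<in> base_slopes x y p r s" "q' \<in> base_slopes x y p r s"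
        "?N (fst i * fst q + snd i) (fst i * snd q + snd i) = ?N (fst j * fst q' + snd j) (fst j * snd q' + snd j)"
      unfolding slopes by blast
    with ij class_system_unique[OF Q, of "fst i" "fst j" q q' "snd i" "snd j"] show False
      by (simp add: inject mem_Times_iff prod_eq_iff)
  qed
  have un: "{U \<in> lines. fst ` U = line x y} = (\<Union>i\<in>cubes \<times> UNIV. ?T i)"
    unfolding lines_over[OF xy]
  proof (intro equalityI subsetI)
    fix U assume "U \<in> {?N p r |p r. p \<noteq> r}"
    then obtain p' r' where U: "U = ?N p' r'" "p' \<noteq> r'"
      by blast
    obtain c q t where "c \<in> cubes" "q \<in> base_slopes x y p r s" "p' = c * fst q + t" "r' = c * snd q + t"
      using class_system_exists[OF Q U(2)] .
    with U(1) show "U \<in> (\<Union>i\<in>cubes \<times> UNIV. ?T i)"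
      unfolding slopes by (intro UN_I[of "(c, t)"]) auto
  next
    fix U assume "U \<in> (\<Union>i\<in>cubes \<times> UNIV. ?T i)"
    then obtain c t q where cq: "c \<in> cubes" "q \<in> base_slopes x y p r s"
        "U = ?N (c * fst q + t) (c * snd q + t)"
      unfolding slopes by auto
    moreover have "c * fst q + t \<noteq> c * snd q + t"
      using class_system_nonzero[OF Q cq(2)] cubes_nonzero[OF cq(1)] by (simp add: add_eq_0)
    ultimately show "U \<in> {?N p r |p r. p \<noteq> r}"
      by blast
  qed
  have "is_triangle (?T i)" if "i \<in> cubes \<times> UNIV" for i
  proof -
    define a b d where abd: "a = (x, x * (fst i * p + snd i))" "b = (y, y * (fst i * r + snd i))"
      "d = (x + y, (x + y) * (fst i * s + snd i))"
    have T: "?T i = {line a b, line b d, line d a}"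
      by (simp add: orbit_triangle_def abd Let_def)
    \<comment> \<open>The sides have three different classes, so they are distinct and the vertices
      are independent.\<close>
    have "card (?T i) = card (base_slopes x y p r s)"
    proof -
      have "inj_on (\<lambda>q. ?N (fst i * fst q + snd i) (fst i * snd q + snd i)) (base_slopes x y p r s)"
        using cubes_nonzero[of "fst i"] that
        by (intro inj_onI) (auto simp: inject prod_eq_iff)
      then show ?thesis
        unfolding slopes by (rule card_image)
    qed
    also have "\<dots> = card {1, \<omega>, \<omega> ^ 2}"
      using Q unfolding class_system_def by (rule bij_betw_same_card)
    also have "\<dots> = 3"
      using omega_neq by simp
    finally have "line a b \<noteq> line b d"
      unfolding T by (auto simp: card_insert_if split: if_splits)
    then show ?thesis
      unfolding T using xy
      by (intro pair.is_triangleI) (auto simp: abd zero_pair_eq add_eq_0)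
  qed
  then have "triangulable ((\<Union>i\<in>cubes \<times> UNIV. ?T i) - (\<Union>i\<in>cubes \<times> S. ?T i))"
    using disj by (intro triangulable_UN_Diff triangulable_triangle) auto
  moreover have "(\<Union>i\<in>cubes \<times> S. ?T i) = (\<Union>c\<in>cubes. \<Union>t\<in>S. orbit_triangle x y p r s c t)"
    by fastforce
  ultimately show ?thesis
    by (simp only: un)
qed

text \<open>With slopes 0, 1, \<open>s\<close> over \<open>x\<close>, \<open>y\<close>,
  \<open>z = x + y\<close> the sides have the classes of 1, \<open>z / x * (1 + s)\<close> and
  \<open>z / y * s\<close>, which a suitable \<open>s\<close> makes different.\<close>

lemma triangulable_over_generic_line:
  assumes xy: "x \<noteq> 0" "y \<noteq> 0" "x \<noteq> y"
  shows "triangulable {U \<in> lines. fst ` U = line x y}"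
proof -
  let ?z = "x + y"
  have "?z \<noteq> 0"
    using xy by (simp add: add_eq_0)
  then obtain s where s: "s \<noteq> 0" "1 + s \<noteq> 0" "(?z / y * s) ^ 21 \<noteq> 1" "(?z / x * (1 + s)) ^ 21 \<noteq> 1"
      "(?z / y * s) ^ 21 \<noteq> (?z / x * (1 + s)) ^ 21"
    using exists_distinct_classes[of "?z / y" "?z / x"] xy by (metis divide_eq_0_iff)
  have nz: "?z / y * s \<noteq> 0" "?z / x * (1 + s) \<noteq> 0"
    using \<open>?z \<noteq> 0\<close> xy s by simp_all
  let ?j = "(?z / x * (1 + s)) ^ 21" and ?k = "(?z / y * s) ^ 21"
  have "(y + ?z * s) / x + 1 = ?z / x * (1 + s)"
    using xy by (simp add: field_simps)
  then have 2: "((y * 1 + ?z * s) / x + 1) ^ 21 = ?j"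
    by (simp only: mult_1_right)
  have 3: "(0 + (x * 0 + ?z * s) / y) ^ 21 = ?k"
    by simp
  have M: "{1, ?j, ?k} = {1, \<omega>, \<omega> ^ 2}"
  proof -
    have "?j = \<omega> \<and> ?k = \<omega> ^ 2 \<or> ?j = \<omega> ^ 2 \<and> ?k = \<omega>"
      using s(3-5) chi_cases[OF nz(1)] chi_cases[OF nz(2)] by metis
    then show ?thesis
      by (elim disjE conjE) (simp_all only: insert_commute)
  qed
  have 1: "(0 + 1) ^ 21 = (1 :: 'f)"
    by simp
  have "class_system (base_slopes x y 0 1 s)"
    unfolding base_slopes_def by (rule class_system_triple[OF 1 2 3 M])
  then show ?thesis
    using triangulable_over_line[OF xy, of 0 1 s "{}"] by simp
qed


section \<open>The triangles mixing different kinds of lines\<close>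

definition special :: "'f set"
  where "special = {1, \<zeta>, 1 + \<zeta>}"

definition next_special :: "('f \<times> 'f) set"
  where "next_special = {(1, \<zeta>), (\<zeta>, 1 + \<zeta>), (1 + \<zeta>, 1)}"

lemma special_nonzero: "u \<in> special \<Longrightarrow> u \<noteq> 0"
  using zeta_neq by (auto simp: special_def)

lemma chi_special: "bij_betw (\<lambda>u. u ^ 21) special {1, \<omega>, \<omega> ^ 2}"
  using omega_neq unfolding bij_betw_def special_def inj_on_def
  by (simp add: chi_zeta chi_zeta_1)

lemma next_special_mem: "(u, u') \<in> next_special \<Longrightarrow> u \<in> special \<and> u' \<in> special \<and> u \<noteq> u'"
  using zeta_neq by (auto simp: next_special_def special_def)

lemma next_special_exists:
  assumes "u \<in> special"
  shows "\<exists>u'. (u, u') \<in> next_special" and "\<exists>u'. (u', u) \<in> next_special"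
  using assms by (auto simp: next_special_def special_def)

lemma next_special_unique:
  assumes "(u, u') \<in> next_special" "(v, v') \<in> next_special"
  shows "u = v \<longleftrightarrow> u' = v'"
  using assms zeta_neq by (auto simp: next_special_def)

text \<open>As \<open>c\<close> is a cube, \<open>u\<close> is recovered from the cubic class of
  \<open>l * u / (l * c)\<close>, and then \<open>l\<close> and \<open>c\<close> from the two
  products.\<close>

lemma special_coordinates_unique:
  assumes "u \<in> special" "u' \<in> special" "l \<noteq> 0" "l' \<noteq> 0" "c \<in> cubes" "c' \<in> cubes"
    and eq: "l * u = l' * u'" "l * c = l' * c'"
  shows "u = u' \<and> l = l' \<and> c = c'"
proof -
  have "(l * c) ^ 21 = (l' * c') ^ 21" "(l * u) ^ 21 = (l' * u') ^ 21"
    by (simp_all only: eq)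
  then have "u ^ 21 = u' ^ 21"
    using assms(3-6) by (simp add: power_mult_distrib cubes_def)
  then have "u = u'"
    using chi_special assms(1,2) unfolding bij_betw_def inj_on_def by blast
  with eq assms(3,4) special_nonzero[OF assms(1)] show ?thesis
    by simp
qed

lemma special_coordinates_exist:
  fixes v s :: 'f
  assumes "v \<noteq> 0" "s \<noteq> 0"
  obtains u l c where "u \<in> special" "l \<noteq> 0" "c \<in> cubes" "v = l * u" "s = l * c"
proof -
  have "v / s \<noteq> 0"
    using assms by simp
  from chi_cases[OF this] obtain u where u: "u \<in> special" "u ^ 21 = (v / s) ^ 21"
    using bij_betw_imp_surj_on[OF chi_special] by (metis (no_types, lifting) imageE insertCI)
  have "u \<noteq> 0"
    using special_nonzero[OF u(1)] .
  moreover from this have "s * u / v \<in> cubes"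
    using u(2) assms by (simp add: cubes_def power_mult_distrib power_divide)
  ultimately show thesis
    using that[of u "v / u" "s * u / v"] u(1) assms by simp
qed

text \<open>
  An index \<open>((u, u'), l, c)\<close> stands for the triangle with vertices \<open>(l u, 0)\<close>, \<open>(0, \<omega>\<^sup>2 l c)\<close>, \<open>(l u', l c)\<close>.
  The cubic classes of \<open>1, \<zeta>, 1 + \<zeta>\<close> being different, \<open>(l u, l c)\<close> and \<open>(l u', l c)\<close> both run exactly once
  through all pairs of nonzero elements.
\<close>

definition mixed_index :: "(('f \<times> 'f) \<times> 'f \<times> 'f) set"
  where "mixed_index = next_special \<times> (- {0}) \<times> cubes"

definition axis_line :: "('f \<times> 'f) \<times> 'f \<times> 'f \<Rightarrow> ('f \<times> 'f) set"
  where "axis_line = (\<lambda>((u, u'), l, c). line (l * u, 0) (0, \<omega> ^ 2 * (l * c)))"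

text \<open>With \<open>s = l * c\<close> the nonzero second coordinates are \<open>s\<close>,
  \<open>\<omega> * s\<close>, \<open>\<omega> ^ 2 * s\<close>: the second projection is a multiple
  of the subfield GF(4).\<close>

definition short_line :: "('f \<times> 'f) \<times> 'f \<times> 'f \<Rightarrow> ('f \<times> 'f) set"
  where "short_line = (\<lambda>((u, u'), l, c). line (0, \<omega> ^ 2 * (l * c)) (l * u', l * c))"

definition level_line :: "('f \<times> 'f) \<times> 'f \<times> 'f \<Rightarrow> ('f \<times> 'f) set"
  where "level_line = (\<lambda>((u, u'), l, c). line (l * u', l * c) (l * u, 0))"

definition mixed_lines :: "('f \<times> 'f) set set"
  where "mixed_lines = axis_line ` mixed_index \<union> short_line ` mixed_index \<union> level_line ` mixed_index"

text \<open>These are the lines over \<open>{0, v}\<close> through \<open>(v, 0)\<close>, which the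
  triangles over \<open>{0, v}\<close> leave out.\<close>

lemma axis_image: "axis_line ` mixed_index = {line (v, 0) (0, w) |(v::'f) (w::'f). v \<noteq> 0 \<and> w \<noteq> 0}"
proof (intro equalityI subsetI)
  fix U assume "U \<in> axis_line ` mixed_index"
  then obtain u u' l c where "(u, u') \<in> next_special" "l \<noteq> 0" "c \<in> cubes"
      "U = line (l * u, 0) (0, \<omega> ^ 2 * (l * c))"
    by (auto simp: axis_line_def mixed_index_def)
  moreover from this have "l * u \<noteq> 0" "\<omega> ^ 2 * (l * c) \<noteq> 0"
    using special_nonzero next_special_mem cubes_nonzero omega_neq(1) by auto
  ultimately show "U \<in> {line (v, 0) (0, w) |(v::'f) (w::'f). v \<noteq> 0 \<and> w \<noteq> 0}"
    by blast
next
  fix U assume "U \<in> {line (v, 0) (0, w) |(v::'f) (w::'f). v \<noteq> 0 \<and> w \<noteq> 0}"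
  then obtain v w where vw: "U = line (v, 0) (0, w)" "v \<noteq> 0" "w \<noteq> 0"
    by blast
  \<comment> \<open>The factor \<omega> cancels the \<open>\<omega> ^ 2\<close> of
    \<open>axis_line\<close>.\<close>
  obtain u l c where *: "u \<in> special" "l \<noteq> 0" "c \<in> cubes" "v = l * u" "\<omega> * w = l * c"
    using special_coordinates_exist[OF vw(2), of "\<omega> * w"] vw(3) omega_neq(1) by auto
  have "w = \<omega> ^ 2 * (l * c)"
    unfolding *(5)[symmetric] by (simp add: omega_mult flip: mult.assoc)
  with * vw(1) next_special_exists(1)[OF *(1)] show "U \<in> axis_line ` mixed_index"
    by (force simp: axis_line_def mixed_index_def image_iff)
qed

lemma short_image: "short_line ` mixed_index = {line (0, \<omega> ^ 2 * s) (y, s) |(y::'f) (s::'f). y \<noteq> 0 \<and> s \<noteq> 0}"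
proof (intro equalityI subsetI)
  fix U assume "U \<in> short_line ` mixed_index"
  then obtain u u' l c where "(u, u') \<in> next_special" "l \<noteq> 0" "c \<in> cubes"
      "U = line (0, \<omega> ^ 2 * (l * c)) (l * u', l * c)"
    by (auto simp: short_line_def mixed_index_def)
  moreover from this have "l * u' \<noteq> 0" "l * c \<noteq> 0"
    using special_nonzero next_special_mem cubes_nonzero by auto
  ultimately show "U \<in> {line (0, \<omega> ^ 2 * s) (y, s) |(y::'f) (s::'f). y \<noteq> 0 \<and> s \<noteq> 0}"
    by blast
next
  fix U assume "U \<in> {line (0, \<omega> ^ 2 * s) (y, s) |(y::'f) (s::'f). y \<noteq> 0 \<and> s \<noteq> 0}"
  then obtain y s where ys: "U = line (0, \<omega> ^ 2 * s) (y, s)" "y \<noteq> 0" "s \<noteq> 0"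
    by blast
  obtain u l c where *: "u \<in> special" "l \<noteq> 0" "c \<in> cubes" "y = l * u" "s = l * c"
    using special_coordinates_exist[OF ys(2,3)] .
  with ys(1) next_special_exists(2)[OF *(1)] show "U \<in> short_line ` mixed_index"
    by (force simp: short_line_def mixed_index_def image_iff)
qed

text \<open>Outside 0, axis lines meet both coordinate axes, short lines only the second and level
  lines only the first, which separates the three kinds. Within a kind the index is recovered by
  \<open>special_coordinates_unique\<close>.\<close>

lemma triangulable_mixed_lines: "triangulable mixed_lines"
  unfolding mixed_lines_def
proof (rule triangulable_family)
  note mem = line_def zero_pair_eq
  have index: thesis
    if "i \<in> mixed_index"
      "\<And>u u' l c. i = ((u, u'), l, c) \<Longrightarrow> (u, u') \<in> next_special \<Longrightarrow> u \<in> special \<Longrightarrow> u' \<in> special \<Longrightarrow>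
        u \<noteq> u' \<Longrightarrow> l \<noteq> 0 \<Longrightarrow> c \<in> cubes \<Longrightarrow> u \<noteq> 0 \<Longrightarrow> u' \<noteq> 0 \<Longrightarrow> c \<noteq> 0 \<Longrightarrow> thesis" for i thesis
  proof -
    obtain u u' l c where i: "i = ((u, u'), l, c)"
      by (metis surj_pair)
    with that(1) have *: "(u, u') \<in> next_special" "l \<noteq> 0" "c \<in> cubes"
      by (auto simp: mixed_index_def)
    with next_special_mem[of u u'] have "u \<in> special" "u' \<in> special" "u \<noteq> u'"
      by simp_all
    with * show thesis
      by (intro that(2)[OF i]) (simp_all add: special_nonzero cubes_nonzero)
  qed
  show "inj_on axis_line mixed_index"
  proof (rule inj_onI)
    fix i j assume i: "i \<in> mixed_index" and j: "j \<in> mixed_index" and eq: "axis_line i = axis_line j"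
    from i obtain u u' l c where i': "i = ((u, u'), l, c)" "(u, u') \<in> next_special" "u \<in> special"
        "l \<noteq> 0" "c \<in> cubes" "u \<noteq> 0" "c \<noteq> 0"
      by (rule index)
    from j obtain v v' m d where j': "j = ((v, v'), m, d)" "(v, v') \<in> next_special" "v \<in> special"
        "m \<noteq> 0" "d \<in> cubes" "v \<noteq> 0" "d \<noteq> 0"
      by (rule index)
    have "(l * u, 0) \<in> axis_line j" "(0, \<omega> ^ 2 * (l * c)) \<in> axis_line j"
      unfolding eq[symmetric] by (simp_all add: i' axis_line_def mem)
    then have "l * u = m * v" "l * c = m * d"
      using i' j' omega_neq(1) by (auto simp: axis_line_def mem)
    then show "i = j"
      using special_coordinates_unique[of u v l m c d] next_special_unique[of u u' v v'] i' j' by simp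
  qed
  show "inj_on short_line mixed_index"
  proof (rule inj_onI)
    fix i j assume i: "i \<in> mixed_index" and j: "j \<in> mixed_index" and eq: "short_line i = short_line j"
    from i obtain u u' l c where i': "i = ((u, u'), l, c)" "(u, u') \<in> next_special" "u' \<in> special"
        "l \<noteq> 0" "c \<in> cubes" "u' \<noteq> 0" "c \<noteq> 0"
      by (rule index)
    from j obtain v v' m d where j': "j = ((v, v'), m, d)" "(v, v') \<in> next_special" "v' \<in> special"
        "m \<noteq> 0" "d \<in> cubes" "v' \<noteq> 0" "d \<noteq> 0"
      by (rule index)
    have "(l * u', l * c) \<in> short_line j" "(0, \<omega> ^ 2 * (l * c)) \<in> short_line j"
      unfolding eq[symmetric] by (simp_all add: i' short_line_def mem)
    then have "l * u' = m * v'" "l * c = m * d"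
      using i' j' omega_neq(1) by (auto simp: short_line_def mem)
    then show "i = j"
      using special_coordinates_unique[of u' v' l m c d] next_special_unique[of u u' v v'] i' j' by simp
  qed
  show "inj_on level_line mixed_index"
  proof (rule inj_onI)
    fix i j assume i: "i \<in> mixed_index" and j: "j \<in> mixed_index" and eq: "level_line i = level_line j"
    from i obtain u u' l c where i': "i = ((u, u'), l, c)" "(u, u') \<in> next_special" "u \<in> special"
        "l \<noteq> 0" "c \<in> cubes" "u \<noteq> 0" "c \<noteq> 0"
      by (rule index)
    from j obtain v v' m d where j': "j = ((v, v'), m, d)" "(v, v') \<in> next_special" "v \<in> special"
        "m \<noteq> 0" "d \<in> cubes" "v \<noteq> 0" "d \<noteq> 0"
      by (rule index)
    have "(l * u, 0) \<in> level_line j" "(l * u', l * c) \<in> level_line j"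
      unfolding eq[symmetric] by (simp_all add: i' level_line_def mem)
    then have "l * u = m * v" "l * c = m * d"
      using i' j' by (auto simp: level_line_def mem)
    then show "i = j"
      using special_coordinates_unique[of u v l m c d] next_special_unique[of u u' v v'] i' j' by simp
  qed
  have ne: "axis_line i \<noteq> short_line j" "axis_line i \<noteq> level_line j" "short_line i \<noteq> level_line j"
    if i: "i \<in> mixed_index" and j: "j \<in> mixed_index" for i j
  proof -
    from i obtain u u' l c where i': "i = ((u, u'), l, c)" "l \<noteq> 0" "u \<noteq> 0" "u' \<noteq> 0" "c \<noteq> 0"
      by (rule index)
    from j obtain v v' m d where j': "j = ((v, v'), m, d)" "m \<noteq> 0" "v \<noteq> 0" "v' \<noteq> 0" "v \<noteq> v'" "d \<noteq> 0"
      by (rule index)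
    have "(l * u, 0) \<in> axis_line i" "(0, \<omega> ^ 2 * (l * c)) \<in> axis_line i" "(0, \<omega> ^ 2 * (l * c)) \<in> short_line i"
      by (simp_all add: i' axis_line_def short_line_def mem)
    moreover have "(l * u, 0) \<notin> short_line j"
    proof -
      have "\<omega> ^ 2 * (m * d) + m * d = (\<omega> ^ 2 + 1) * (m * d)"
        by (simp add: algebra_simps)
      also have "\<dots> = \<omega> * (m * d)"
        by (simp add: omega_root add.assoc add_self)
      finally show ?thesis
        using i' j' omega_neq(1) by (auto simp: short_line_def mem)
    qed
    moreover have "(0, \<omega> ^ 2 * (l * c)) \<notin> level_line j"
      using i' j' omega_neq(1) by (auto simp: level_line_def mem add_eq_0)
    ultimately show "axis_line i \<noteq> short_line j" "axis_line i \<noteq> level_line j" "short_line i \<noteq> level_line j"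
      by metis+
  qed
  then show "axis_line i \<noteq> short_line j \<and> axis_line i \<noteq> level_line j \<and> short_line i \<noteq> level_line j"
    if "i \<in> mixed_index" "j \<in> mixed_index" for i j
    using that by blast
  show "is_triangle {axis_line i, short_line i, level_line i}" if i: "i \<in> mixed_index" for i
  proof -
    from i obtain u u' l c where i': "i = ((u, u'), l, c)" "l \<noteq> 0" "u \<noteq> 0" "u' \<noteq> 0" "c \<noteq> 0" "u \<noteq> u'"
      by (rule index)
    let ?a = "(l * u, 0)" and ?b = "(0, \<omega> ^ 2 * (l * c))" and ?d = "(l * u', l * c)"
    have "is_triangle {line ?a ?b, line ?b ?d, line ?d ?a}"
    proof (rule pair.is_triangleI)
      show "line ?a ?b \<noteq> line ?b ?d"
        using ne(1)[OF i i] i' by (simp add: axis_line_def short_line_def)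
    qed (use i' omega_neq(1) in \<open>auto simp: zero_pair_eq\<close>)
    then show ?thesis
      by (simp add: i' axis_line_def short_line_def level_line_def)
  qed
qed


section \<open>Recognizing mixed lines, and the remaining lines over \<open>{0, v}\<close>\<close>

lemma cube_eq_iff: "w ^ 3 = u ^ 3 \<longleftrightarrow> w = u \<or> w = \<omega> * u \<or> w = \<omega> ^ 2 * u" for u w :: 'f
proof -
  have "(w - u) * ((w - \<omega> * u) * (w - \<omega> ^ 2 * u)) = w ^ 3 - u ^ 3"
    using omega_sum by algebra
  moreover have "w ^ 3 = u ^ 3 \<longleftrightarrow> w ^ 3 - u ^ 3 = 0"
    by simp
  ultimately have "w ^ 3 = u ^ 3 \<longleftrightarrow> (w - u) * ((w - \<omega> * u) * (w - \<omega> ^ 2 * u)) = 0"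
    by metis
  then show ?thesis
    unfolding mult_eq_0_iff right_minus_eq .
qed

lemma level_lineE:
  assumes "U \<in> level_line ` mixed_index"
  obtains u u' l c where "(u, u') \<in> next_special" "l \<noteq> 0" "c \<in> cubes"
    "U = level_line ((u, u'), l, c)"
  using assms by (auto simp: mixed_index_def)

lemma zeta_power2_neq: "\<zeta> ^ 2 \<noteq> 1" "\<zeta> ^ 2 \<noteq> \<zeta>" "\<zeta> ^ 2 \<noteq> 1 + \<zeta>" "\<zeta> + \<zeta> ^ 2 \<noteq> 1"
proof -
  show "\<zeta> ^ 2 \<noteq> \<zeta>"
    using zeta_neq by (simp add: power2_eq_square)
  have "(1 + \<zeta>) ^ 2 = 1 + \<zeta> ^ 2"
    by (simp add: add_power2)
  then show "\<zeta> ^ 2 \<noteq> 1"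
    using zeta_neq(2) by (auto simp: add_self)
  have "\<zeta> ^ 2 + (1 + \<zeta>) \<noteq> 0" "(\<zeta> + \<zeta> ^ 2) + 1 \<noteq> 0"
    using zeta_sum by (simp_all add: add.assoc add.commute add.left_commute)
  then show "\<zeta> ^ 2 \<noteq> 1 + \<zeta>" "\<zeta> + \<zeta> ^ 2 \<noteq> 1"
    by (simp_all only: add_eq_0 not_False_eq_True)
qed

lemma fst_level_line:
  assumes "(u, u') \<in> next_special" "l \<noteq> 0"
  shows "fst ` level_line ((u, u'), l, c) = line l (l * \<zeta>)"
proof -
  have "line (l * u') (l * u) = line l (l * \<zeta>)"
  proof (rule line_eqI)
    show "l * u' \<in> line l (l * \<zeta>)" "l * u \<in> line l (l * \<zeta>)"
      using assms(1) by (auto simp: next_special_def line_def distrib_left)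
    show "l * u' \<noteq> 0" "l * u \<noteq> 0" "l * u' \<noteq> l * u"
      using assms special_nonzero next_special_mem[OF assms(1)] by auto
  qed
  then show ?thesis
    by (simp add: level_line_def fst_line)
qed

text \<open>Multiplication by \<open>t\<close> preserves \<open>{0, 1, \<zeta>, 1 + \<zeta>}\<close>
  only for \<open>t = 1\<close>, as \<zeta> satisfies no quadratic equation over F_2.\<close>

lemma special_line_unique:
  assumes "line l (l * \<zeta>) = line m (m * \<zeta>)" "l \<noteq> 0" "m \<noteq> 0"
  shows "l = m"
proof -
  define t where "t = l / m"
  have l: "l = m * t" and "t \<noteq> 0"
    using assms by (simp_all add: t_def)
  have "l \<in> line m (m * \<zeta>)" "l * \<zeta> \<in> line m (m * \<zeta>)"
    unfolding assms(1)[symmetric] by (simp_all add: line_def)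
  then have "t = 1 \<or> t = \<zeta> \<or> t = 1 + \<zeta>" "t * \<zeta> = 1 \<or> t * \<zeta> = \<zeta> \<or> t * \<zeta> = 1 + \<zeta>"
    using assms(3) \<open>t \<noteq> 0\<close> zeta_neq(1) by (simp_all add: l line_def mult.assoc flip: distrib_left)
      (simp_all add: distrib_left[symmetric, of m 1, simplified] flip: mult.assoc)
  then have "t = 1"
    using zeta_power2_neq zeta_neq
    by (auto simp: distrib_right power2_eq_square[symmetric] add.commute)
  then show ?thesis
    by (simp add: l)
qed

text \<open>For \<open>w = 0\<close> and \<open>w = u\<close> the line contains
  \<open>(v, 0)\<close> and is an axis line; for \<open>w = \<omega> * u\<close> and
  \<open>w = \<omega> ^ 2 * u\<close> it is a short line. Level lines never project onto
  \<open>{0, v}\<close>.\<close>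

lemma mixed_point_line_iff:
  assumes "u \<noteq> 0" "v \<noteq> 0"
  shows "line (0, u) (v, w) \<in> mixed_lines \<longleftrightarrow> w = 0 \<or> w ^ 3 = u ^ 3"
proof
  let ?U = "line (0, u) (v, w)"
  have U: "?U = {(0, 0), (0, u), (v, w), (v, u + w)}"
    by (simp add: line_def zero_pair_eq)
  assume "?U \<in> mixed_lines"
  then consider "?U \<in> axis_line ` mixed_index" | "?U \<in> short_line ` mixed_index"
    | "?U \<in> level_line ` mixed_index"
    unfolding mixed_lines_def by blast
  then show "w = 0 \<or> w ^ 3 = u ^ 3"
  proof cases
    case 1
    then obtain v' w' where v': "?U = line (v', 0) (0, w')" "v' \<noteq> 0"
      unfolding axis_image by blast
    have "(v', 0) \<in> ?U"
      unfolding v'(1) by (simp add: line_def)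
    then show ?thesis
      using v'(2) by (auto simp: U add_eq_0)
  next
    case 2
    then obtain y s where ys: "?U = line (0, \<omega> ^ 2 * s) (y, s)" "y \<noteq> 0" "s \<noteq> 0"
      unfolding short_image by blast
    have "(0, \<omega> ^ 2 * s) \<in> ?U" "(y, s) \<in> ?U"
      unfolding ys(1) by (simp_all add: line_def)
    then have u: "u = \<omega> ^ 2 * s" and "s = w \<or> s = u + w"
      using ys assms omega_neq(1) by (auto simp: U)
    then have "w = s \<or> w = \<omega> * s"
    proof (elim disjE)
      assume "s = u + w"
      then have "w = u + s"
        by (simp add: add_self_left)
      also have "\<dots> = \<omega> * s"
        by (simp add: u omega_root distrib_right add.assoc add_self)
      finally show ?thesis ..
    qed simp
    then have "w ^ 3 = s ^ 3"
      unfolding cube_eq_iff by blast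
    moreover have "u ^ 3 = s ^ 3"
      unfolding cube_eq_iff u by blast
    ultimately show ?thesis
      by simp
  next
    case 3
    then obtain a b l c where abc: "(a, b) \<in> next_special" "l \<noteq> 0" "?U = level_line ((a, b), l, c)"
      by (rule level_lineE)
    have "line l (l * \<zeta>) = {0, v}"
      using fst_level_line[OF abc(1,2), of c] by (simp add: abc(3)[symmetric] fst_line line_0)
    moreover have "l \<in> line l (l * \<zeta>)" "l * \<zeta> \<in> line l (l * \<zeta>)"
      by (simp_all add: line_def)
    ultimately show ?thesis
      using abc(2) zeta_neq by auto
  qed
next
  let ?U = "line (0, u) (v, w)"
  have lines: "?U \<in> lines"
    using assms by (simp add: line_in_lines_iff det_def)
  assume "w = 0 \<or> w ^ 3 = u ^ 3"
  then consider "w = 0 \<or> w = u" | "w = \<omega> * u \<or> w = \<omega> ^ 2 * u"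
    unfolding cube_eq_iff by blast
  then show "?U \<in> mixed_lines"
  proof cases
    case 1
    then have "?U = line (v, 0) (0, u)"
      using assms by (intro lines_eqI[OF lines]) (auto simp: line_def zero_pair_eq add_self)
    then show ?thesis
      using assms unfolding mixed_lines_def axis_image by blast
  next
    case 2
    \<comment> \<open>If \<open>w = \<omega> ^ 2 * u\<close>, the other point over \<open>v\<close>
      has second coordinate \<open>\<omega> * u\<close>.\<close>
    have "\<omega> ^ 2 * u + u = \<omega> * u"
      by (simp add: omega_root distrib_right add.assoc add_self)
    with 2 have "(v, \<omega> * u) \<in> ?U"
      by (auto simp: line_def add.commute)
    then have "?U = line (0, u) (v, \<omega> * u)"
      using assms by (intro lines_eqI[OF lines]) (auto simp: line_def zero_pair_eq)
    then have "?U = line (0, \<omega> ^ 2 * (\<omega> * u)) (v, \<omega> * u)"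
      by (simp add: omega_mult flip: mult.assoc)
    moreover have "\<omega> * u \<noteq> 0"
      using assms omega_neq(1) by simp
    ultimately show ?thesis
      using assms unfolding mixed_lines_def short_image by blast
  qed
qed

text \<open>The projection is additive with image \<open>{0, v}\<close>, so one of \<open>a\<close>,
  \<open>b\<close>, \<open>a + b\<close> lies over 0.\<close>

lemma point_lineE:
  assumes "U \<in> lines" "fst ` U = line 0 v" "v \<noteq> 0"
  obtains u w where "u \<noteq> 0" "U = line (0, u) (v, w)"
proof -
  obtain a b where U: "U = line a b" "det a b \<noteq> 0"
    using assms(1) unfolding lines_def by blast
  have "fst a \<in> {0, v}" "fst b \<in> {0, v}"
    using assms(2) unfolding U(1) line_0[symmetric] by (auto simp: line_def)
  then have "fst a = 0 \<or> fst b = 0 \<or> fst (a + b) = 0"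
    by (auto simp: add_self)
  moreover have "a \<noteq> 0" "b \<noteq> 0" "a + b \<noteq> 0"
    using det_neq_0D[OF U(2)] by (simp_all add: pair.add_eq_0)
  ultimately obtain e where e: "e \<in> U" "fst e = 0" "e \<noteq> 0"
    unfolding U(1) line_def by blast
  have "v \<in> fst ` U"
    by (simp add: assms(2) line_def)
  then obtain w where "(v, w) \<in> U"
    by auto
  then have "U = line e (v, w)"
    using e assms(1,3) by (intro lines_eqI) (auto simp: zero_pair_eq)
  with e that[of "snd e" w] show thesis
    by (metis prod.collapse zero_pair_eq)
qed

text \<open>Sort the lines also by their second projection. The fibre of
  \<open>{0, u, w, u + w}\<close> consists of the three edges between the points of heights
  \<open>u\<close>, \<open>w\<close>, \<open>u + w\<close> over \<open>v\<close>, and these are the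
  sides of a triangle.\<close>

lemma triangulable_over_point:
  assumes v: "v \<noteq> 0"
  shows "triangulable {U \<in> lines - mixed_lines. fst ` U = line 0 v}" (is "triangulable ?L")
proof (rule triangulable_fibres)
  fix U assume U: "U \<in> ?L"
  then obtain u w where uw: "u \<noteq> 0" "U = line (0, u) (v, w)"
    using v by (elim CollectE conjE DiffE) (rule point_lineE)
  with U v have w: "w \<noteq> 0" "w ^ 3 \<noteq> u ^ 3"
    by (auto simp: mixed_point_line_iff)
  then have "w \<noteq> u" by auto
  let ?T = "{line (v, w) (v, u), line (v, u) (v, u + w), line (v, u + w) (v, w)}"
  have T: "line (v, w) (v, u) = line (0, u + w) (v, w)" "line (v, u) (v, u + w) = line (0, w) (v, u)"
      "line (v, u + w) (v, w) = line (0, u) (v, w)"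
    using line_in_add[of "(v, w)" "(v, u)"] line_in_add[of "(v, u)" "(v, u + w)"]
      line_in_add[of "(v, w)" "(v, u + w)"] line_commute[of "(v, u + w)" "(v, w)"]
    by (simp_all add: add_self add_self_left add.commute add.left_commute)
  have snd_eq: "line (u + w) w = line u w" "line w u = line u w"
    using uw w \<open>w \<noteq> u\<close> by (auto intro!: line_eqI simp: line_def add_eq_0 two_eq_0)
  have sum: "u + w \<noteq> 0"
    using \<open>w \<noteq> u\<close> by (simp add: add_eq_0)
  \<comment> \<open>No edge of the triangle is mixed: if \<open>w\<close> is not \<open>u\<close>
    times a cube root of unity, it is not \<open>u + w\<close> times one either.\<close>
  have cube: "w ^ 3 \<noteq> (u + w) ^ 3"
  proof
    assume "w ^ 3 = (u + w) ^ 3"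
    then have "w = \<omega> * (u + w) \<or> w = \<omega> ^ 2 * (u + w)"
      using uw(1) unfolding cube_eq_iff by simp
    then have "u = \<omega> * w \<or> u = \<omega> ^ 2 * w"
    proof (elim disjE)
      assume "w = \<omega> * (u + w)"
      then have "\<omega> ^ 2 * w = u + w"
        by (metis mult.assoc omega_mult(3) mult_1)
      then have "u = \<omega> ^ 2 * w + w"
        by (simp add: add.assoc add_self)
      then show ?thesis
        by (simp add: omega_root distrib_right add.assoc add_self)
    next
      assume "w = \<omega> ^ 2 * (u + w)"
      then have "\<omega> * w = u + w"
        by (metis mult.assoc omega_mult(2) mult_1)
      then have "u = \<omega> * w + w"
        by (simp add: add.assoc add_self)
      then show ?thesis
        by (simp add: omega_root distrib_right)
    qed
    then have "u ^ 3 = w ^ 3"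
      unfolding cube_eq_iff by blast
    with w show False by simp
  qed
  have "{U' \<in> ?L. snd ` U' = snd ` U} = ?T"
  proof (intro equalityI subsetI)
    fix U' assume U': "U' \<in> {U' \<in> ?L. snd ` U' = snd ` U}"
    then obtain u' w' where uw': "u' \<noteq> 0" "U' = line (0, u') (v, w')"
      using v by (elim CollectE conjE DiffE) (rule point_lineE)
    with U' v have w': "w' \<noteq> 0" "w' \<noteq> u'"
      by (auto simp: mixed_point_line_iff)
    have eq: "U' = line (v, w') (v, u' + w')"
      using line_in_add[of "(v, w')" "(v, u' + w')"]
      by (simp add: uw'(2) add_self add_self_left add.commute add.left_commute)
    have "u' \<in> snd ` U'" "w' \<in> snd ` U'"
      unfolding uw'(2) by (force simp: line_def)+
    then have "u' \<in> {u, w, u + w}" "w' \<in> {u, w, u + w}"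
      using U' uw'(1) w'(1) by (auto simp: uw(2) snd_line line_def[of u w])
    then show "U' \<in> ?T"
      unfolding eq using w'(2)
      by (elim insertE emptyE)
        (simp_all add: add_self add_self_left add.commute add.left_commute line_commute)
  next
    have mem: "line (0, a) (v, b) \<in> {U' \<in> ?L. snd ` U' = snd ` U}"
      if "a \<noteq> 0" "b \<noteq> 0" "b ^ 3 \<noteq> a ^ 3" "line a b = line u w" for a b
    proof -
      have "line (0, a) (v, b) \<in> lines" "line (0, a) (v, b) \<notin> mixed_lines"
        using that v by (simp_all add: line_in_lines_iff det_def mixed_point_line_iff)
      then show ?thesis
        using that(4) by (simp add: uw(2) fst_line snd_line)
    qed
    fix U' assume "U' \<in> ?T"
    then consider "U' = line (0, u + w) (v, w)" | "U' = line (0, w) (v, u)" | "U' = line (0, u) (v, w)"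
      unfolding T by blast
    then show "U' \<in> {U' \<in> ?L. snd ` U' = snd ` U}"
    proof cases
      case 1
      show ?thesis unfolding 1 by (rule mem[OF sum w(1) cube snd_eq(1)])
    next
      case 2
      show ?thesis unfolding 2 by (rule mem[OF w(1) uw(1) w(2)[symmetric] snd_eq(2)])
    next
      case 3
      show ?thesis unfolding 3 by (rule mem[OF uw(1) w refl])
    qed
  qed
  moreover have "is_triangle ?T"
  proof (rule pair.is_triangleI)
    have "(v, w) \<notin> line (v, u) (v, u + w)"
      using v uw w \<open>w \<noteq> u\<close> by (auto simp: line_def zero_pair_eq)
    moreover have "(v, w) \<in> line (v, w) (v, u)"
      by (simp add: line_def)
    ultimately show "line (v, w) (v, u) \<noteq> line (v, u) (v, u + w)"
      by blast
  qed (use v uw w \<open>w \<noteq> u\<close> in \<open>auto simp: zero_pair_eq\<close>)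
  ultimately show "triangulable {U' \<in> ?L. snd ` U' = snd ` U}"
    by (simp only: triangulable_triangle)
qed


text \<open>These slopes place the three vertices at equal height, so each side passes through a
  point \<open>(l * u, 0)\<close> with \<open>u\<close> in \<open>special\<close>, as a level line
  does.\<close>

lemma class_system_special:
  assumes "l \<noteq> 0"
  shows "class_system (base_slopes l (l * \<zeta>) 1 (inverse \<zeta>) (inverse (1 + \<zeta>)))"
proof -
  have l: "l + l * \<zeta> = l * (1 + \<zeta>)"
    by (simp add: distrib_left)
  have z: "(l * \<zeta> * inverse \<zeta> + (l + l * \<zeta>) * inverse (1 + \<zeta>)) / l = 0"
    "(l * 1 + (l + l * \<zeta>) * inverse (1 + \<zeta>)) / (l * \<zeta>) = 0"
    using zeta_neq assms by (simp_all add: l mult.assoc add_self)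
  have slopes: "base_slopes l (l * \<zeta>) 1 (inverse \<zeta>) (inverse (1 + \<zeta>)) =
      {(1, inverse \<zeta>), (0, inverse \<zeta>), (1, 0)}"
    unfolding base_slopes_def z ..
  have "1 + inverse \<zeta> = (1 + \<zeta>) * inverse \<zeta>"
    using zeta_neq by (simp add: field_simps)
  then have "(1 + inverse \<zeta>) ^ 21 = \<omega>"
    by (simp add: power_mult_distrib power_inverse chi_zeta chi_zeta_1 omega_inverse omega_mult omega_4)
  moreover have "(0 + inverse \<zeta>) ^ 21 = \<omega> ^ 2" "(1 + 0) ^ 21 = (1::'f)"
    by (simp_all add: power_inverse chi_zeta omega_inverse)
  ultimately show ?thesis
    unfolding slopes by (intro class_system_triple[of _ _ \<omega> _ _ "\<omega> ^ 2" _ _ 1]) auto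
qed

text \<open>Over \<open>l, l \<zeta>\<close>, the lines used up by the mixed triangles form complete triangles.\<close>

lemma level_lines_orbit:
  assumes "l \<noteq> 0"
  shows "orbit_triangle l (l * \<zeta>) 1 (inverse \<zeta>) (inverse (1 + \<zeta>)) c 0 =
    (\<lambda>e. level_line (e, l, c)) ` next_special"
proof -
  let ?a = "(l, l * c)" and ?b = "(l * \<zeta>, l * c)" and ?d = "(l * (1 + \<zeta>), l * c)"
  have sums: "?b + ?d = (l, 0)" "?d + ?a = (l * \<zeta>, 0)" "?a + ?b = (l * (1 + \<zeta>), 0)"
    by (simp_all add: distrib_left add_self add_self_left add.commute add.left_commute)
  have "line b c = line b (b + c)" for b c :: "'f \<times> 'f"
    by (rule trans[OF line_in_add line_commute])
  from this[of ?b ?d] this[of ?d ?a] this[of ?a ?b]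
  have lines: "line ?b ?d = line ?b (l, 0)" "line ?d ?a = line ?d (l * \<zeta>, 0)"
    "line ?a ?b = line ?a (l * (1 + \<zeta>), 0)"
    unfolding sums .
  have "orbit_triangle l (l * \<zeta>) 1 (inverse \<zeta>) (inverse (1 + \<zeta>)) c 0 = {line ?a ?b, line ?b ?d, line ?d ?a}"
  proof -
    have 1: "l + l * \<zeta> = l * (1 + \<zeta>)"
      by (simp add: distrib_left)
    have 2: "l * (1 + \<zeta>) * (c * inverse (1 + \<zeta>)) = l * c" "l * \<zeta> * (c * inverse \<zeta>) = l * c"
      using zeta_neq by simp_all
    show ?thesis
      unfolding orbit_triangle_def Let_def add_0_right mult_1_right 1 2 ..
  qed
  also have "\<dots> = (\<lambda>e. level_line (e, l, c)) ` next_special"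
    unfolding lines by (simp add: next_special_def level_line_def insert_commute)
  finally show ?thesis .
qed

lemma triangulable_over_plane_line:
  assumes xy: "x \<noteq> 0" "y \<noteq> 0" "x \<noteq> y"
  shows "triangulable {U \<in> lines - mixed_lines. fst ` U = line x y}"
proof -
  let ?F = "{U \<in> lines. fst ` U = line x y}"
  have mixed: "U \<in> mixed_lines \<longleftrightarrow> U \<in> level_line ` mixed_index" if U: "fst ` U = line x y" for U
  proof -
    have "line v 0 \<noteq> line x y" for v
      using xy by (auto simp: line_def add_eq_0)
    then have "U \<notin> axis_line ` mixed_index" "U \<notin> short_line ` mixed_index"
      using U unfolding axis_image short_image by (auto simp: fst_line line_commute[of 0])
    then show ?thesis
      by (simp add: mixed_lines_def)
  qed
  show ?thesis
  proof (cases "\<exists>l. l \<noteq> 0 \<and> line x y = line l (l * \<zeta>)")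
    case True
    then obtain l where l: "l \<noteq> 0" "line x y = line l (l * \<zeta>)"
      by blast
    have nz: "l * \<zeta> \<noteq> 0" "l \<noteq> l * \<zeta>"
      using l zeta_neq by auto
    let ?O = "orbit_triangle l (l * \<zeta>) 1 (inverse \<zeta>) (inverse (1 + \<zeta>))"
    have level: "U \<in> level_line ` mixed_index \<longleftrightarrow> U \<in> (\<Union>c\<in>cubes. \<Union>t\<in>{0}. ?O c t)"
      if U: "fst ` U = line x y" for U
    proof
      assume "U \<in> level_line ` mixed_index"
      then obtain u u' m c where m: "(u, u') \<in> next_special" "m \<noteq> 0" "c \<in> cubes"
          "U = level_line ((u, u'), m, c)"
        by (auto simp: mixed_index_def)
      then have "m = l"
        using fst_level_line[OF m(1,2), of c] U l by (intro special_line_unique) simp_all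
      with m l show "U \<in> (\<Union>c\<in>cubes. \<Union>t\<in>{0}. ?O c t)"
        by (auto simp: level_lines_orbit)
    next
      assume "U \<in> (\<Union>c\<in>cubes. \<Union>t\<in>{0}. ?O c t)"
      then show "U \<in> level_line ` mixed_index"
        using l(1) by (auto simp: level_lines_orbit mixed_index_def)
    qed
    have "{U \<in> lines - mixed_lines. fst ` U = line x y} = ?F - (\<Union>c\<in>cubes. \<Union>t\<in>{0}. ?O c t)"
      by (auto simp: mixed level)
    then show ?thesis
      using triangulable_over_line[OF l(1) nz class_system_special[OF l(1)], of "{0}"]
      by (simp only: l(2))
  next
    case False
    have "U \<notin> level_line ` mixed_index" if U: "fst ` U = line x y" for U
    proof
      assume "U \<in> level_line ` mixed_index"
      then obtain u u' m c where m: "(u, u') \<in> next_special" "m \<noteq> 0" "U = level_line ((u, u'), m, c)"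
        by (rule level_lineE)
      with U fst_level_line[OF m(1,2), of c] False show False
        by auto
    qed
    then have "{U \<in> lines - mixed_lines. fst ` U = line x y} = ?F"
      by (auto simp: mixed)
    then show ?thesis
      using triangulable_over_generic_line[OF xy] by (simp only:)
  qed
qed

section \<open>All lines that span the plane\<close>

lemma mixed_lines_subset: "mixed_lines \<subseteq> lines"
proof
  fix U assume "U \<in> mixed_lines"
  then consider "U \<in> axis_line ` mixed_index" | "U \<in> short_line ` mixed_index"
    | "U \<in> level_line ` mixed_index"
    unfolding mixed_lines_def by blast
  then show "U \<in> lines"
  proof cases
    case 1
    then show ?thesis
      unfolding axis_image by (auto simp: line_in_lines_iff det_def)
  next
    case 2
    then show ?thesis
      unfolding short_image using omega_neq(1) by (auto simp: line_in_lines_iff det_def)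
  next
    case 3
    then obtain u u' l c where ulc: "(u, u') \<in> next_special" "l \<noteq> 0" "c \<in> cubes"
        "U = level_line ((u, u'), l, c)"
      by (rule level_lineE)
    then show ?thesis
      using next_special_mem[OF ulc(1)]
      by (simp add: level_line_def line_in_lines_iff det_def special_nonzero cubes_nonzero)
  qed
qed

lemma triangulable_lines: "triangulable lines"
proof -
  have "triangulable (lines - mixed_lines)"
  proof (rule triangulable_fibres)
    fix U assume "U \<in> lines - mixed_lines"
    then obtain a b where U: "U = line a b" "det a b \<noteq> 0"
      unfolding lines_def by blast
    let ?x = "fst a" and ?y = "fst b"
    have F: "fst ` U = line ?x ?y"
      by (simp add: U(1) fst_line)
    have "?x \<noteq> 0 \<or> ?y \<noteq> 0"
      using U(2) by (auto simp: det_def)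
    \<comment> \<open>The first three cases are the ways in which the projection shrinks to
      \<open>{0, v}\<close>.\<close>
    then consider "?x = 0" "?y \<noteq> 0" | "?x \<noteq> 0" "?y = 0" | "?x \<noteq> 0" "?y = ?x" | "?x \<noteq> 0" "?y \<noteq> 0" "?x \<noteq> ?y"
      by metis
    then show "triangulable {U' \<in> lines - mixed_lines. fst ` U' = fst ` U}"
    proof cases
      case 1
      then show ?thesis
        using F triangulable_over_point[of ?y] by simp
    next
      case 2
      then show ?thesis
        using F triangulable_over_point[of ?x] by (simp add: line_commute[of _ 0])
    next
      case 3
      moreover have "line ?x ?x = line 0 ?x"
        by (auto simp: line_def add_self)
      ultimately show ?thesis
        using F triangulable_over_point[of ?x] by simp
    next
      case 4
      then show ?thesis
        using F triangulable_over_plane_line[of ?x ?y] by simp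
    qed
  qed
  then have "triangulable (mixed_lines \<union> (lines - mixed_lines))"
    by (intro triangulable_Un triangulable_mixed_lines) auto
  then show ?thesis
    using mixed_lines_subset by (simp add: Un_absorb1)
qed

end

section \<open>Transfer to vector spaces\<close>

text \<open>Adjoining \<open>b\<close> multiplies the size by that of the field. Counting will serve
  to compare dimensions over F and F_2.\<close>

lemma (in vector_space) card_span_independent:
  assumes "finite (UNIV :: 'a set)" "finite B" "independent B"
  shows "card (span B) = card (UNIV :: 'a set) ^ card B"
  using assms(2,3)
proof (induction rule: finite_induct)
  case (insert b B)
  then have B: "independent B" "b \<notin> span B"
    by (auto simp: independent_insert)
  have "bij_betw (\<lambda>(k, x). k *s b + x) (UNIV \<times> span B) (span (insert b B))"
    unfolding bij_betw_def
  proof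
    show "inj_on (\<lambda>(k, x). k *s b + x) (UNIV \<times> span B)"
    proof (rule inj_onI, clarify)
      fix k x l y assume xy: "x \<in> span B" "y \<in> span B" "k *s b + x = l *s b + y"
      then have "(k - l) *s b = y - x"
        by (simp add: scale_left_diff_distrib algebra_simps)
      then have *: "(k - l) *s b \<in> span B"
        using xy by (simp add: span_diff)
      have "k - l = 0"
      proof (rule ccontr)
        assume "k - l \<noteq> 0"
        then have "b = inverse (k - l) *s ((k - l) *s b)"
          by simp
        then show False
          using span_scale[OF *, of "inverse (k - l)"] B(2) by simp
      qed
      with xy(3) show "k = l \<and> x = y"
        by simp
    qed
    show "(\<lambda>(k, x). k *s b + x) ` (UNIV \<times> span B) = span (insert b B)"
    proof (intro equalityI subsetI)
      fix y assume "y \<in> (\<lambda>(k, x). k *s b + x) ` (UNIV \<times> span B)"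
      then obtain k x where "y = k *s b + x" "x \<in> span B"
        by auto
      then have "y - k *s b \<in> span B"
        by simp
      then show "y \<in> span (insert b B)"
        by (auto simp: span_breakdown_eq)
    next
      fix y assume "y \<in> span (insert b B)"
      then obtain k where "y - k *s b \<in> span B"
        by (auto simp: span_breakdown_eq)
      then show "y \<in> (\<lambda>(k, x). k *s b + x) ` (UNIV \<times> span B)"
        by (intro image_eqI[of _ _ "(k, y - k *s b)"]) simp_all
    qed
  qed
  then have "card (span (insert b B)) = card ((UNIV :: 'a set) \<times> span B)"
    by (metis bij_betw_same_card)
  with insert B show ?case
    by (simp add: card_cartesian_product)
qed simp

section \<open>Restriction of scalars to F_2\<close>

locale vector_space_64 = vector_space scale + field_64 "TYPE('f)"
  for scale :: "'f::{field,finite} \<Rightarrow> 'v::ab_group_add \<Rightarrow> 'v" (infixr "*s" 75)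
begin

sublocale vec: char_two "TYPE('v)"
proof
  fix x :: 'v
  have "x + x = (1 + 1) *s x"
    by (simp only: scale_left_distrib scale_one)
  then show "x + x = 0"
    by (simp add: two_eq_0)
qed

lemma scale_bit_eq: "scale_bit (*s) c v = (if c = 0 then 0 else v)"
  by (cases c) (simp_all add: scale_bit_def)

sublocale bit: vector_space "scale_bit (*s)"
proof
  show "scale_bit (*s) a (x + y) = scale_bit (*s) a x + scale_bit (*s) a y" for a x y
    by (simp add: scale_bit_eq)
  show "scale_bit (*s) (a + b) x = scale_bit (*s) a x + scale_bit (*s) b x" for a b x
    by (cases a; cases b) (simp_all add: scale_bit_eq vec.add_self)
  show "scale_bit (*s) a (scale_bit (*s) b x) = scale_bit (*s) (a * b) x" for a b x
    by (simp add: scale_bit_eq)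
  show "scale_bit (*s) 1 x = x" for x
    by (simp add: scale_bit_eq)
qed

lemma ex_bit: "(\<exists>c::bit. P c) \<longleftrightarrow> P 0 \<or> P 1"
  by (metis (full_types) bit.exhaust)

lemma bit_span_pair: "bit.span {a, b} = line a b"
  by (auto simp: bit.span_insert ex_bit scale_bit_eq line_def add.commute vec.two_simps)

lemma bit_independent_pair: "bit.independent {a, b} \<longleftrightarrow> a \<noteq> 0 \<and> b \<noteq> 0" if "a \<noteq> b"
  using that
  by (auto simp: bit.independent_insert bit.span_insert ex_bit scale_bit_eq vec.two_simps)

lemma bit_triangle:
  assumes "is_triangle T"
  shows "bit.triangle T"
proof -
  obtain a b c where abc: "a \<noteq> 0" "b \<noteq> 0" "a \<noteq> b" "c \<notin> line a b"
      "T = {line a b, line b c, line c a}"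
    using assms unfolding is_triangle_def by blast
  have "distinct [a, b, c]"
    using abc by (auto simp: line_def)
  moreover have "bit.independent {a, b, c}"
  proof -
    have "bit.independent {a, b}"
      unfolding bit_independent_pair[OF abc(3)] using abc by simp
    then have "bit.independent (insert c {a, b})"
      by (rule bit.independent_insertI[rotated]) (simp add: bit_span_pair abc(4))
    then show ?thesis
      by (simp add: insert_commute)
  qed
  ultimately show ?thesis
    unfolding bit.triangle_def abc(5) by (intro exI[of _ a] exI[of _ b] exI[of _ c]) (simp add: bit_span_pair)
qed

section \<open>Lines contained in no group, sorted by the F-planes they span\<close>

definition plane_lines :: "'v set set"
  where "plane_lines = {line x y |x y. x \<noteq> 0 \<and> y \<notin> span {x}}"

text \<open>Coordinates that match \<open>F \<times> F\<close> with the F-plane spanned by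
  independent \<open>x\<close> and \<open>y\<close>.\<close>

definition comb :: "'v \<Rightarrow> 'v \<Rightarrow> 'f \<times> 'f \<Rightarrow> 'v"
  where "comb x y a = fst a *s x + snd a *s y"

lemma comb_add: "comb x y (a + b) = comb x y a + comb x y b"
  by (simp add: comb_def scale_left_distrib algebra_simps)

lemma span_pair: "span {x, y} = range (comb x y)"
  by (force simp: span_insert span_singleton comb_def algebra_simps image_iff)

lemma inj_comb:
  assumes "x \<noteq> 0" "y \<notin> span {x}"
  shows "inj (comb x y)"
proof (rule injI)
  fix a b assume "comb x y a = comb x y b"
  then have *: "(fst a - fst b) *s x = (snd b - snd a) *s y"
    by (simp add: comb_def scale_left_diff_distrib algebra_simps)
  have "snd b - snd a = 0"
  proof (rule ccontr)
    assume nz: "snd b - snd a \<noteq> 0"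
    then have "y = inverse (snd b - snd a) *s ((snd b - snd a) *s y)"
      by simp
    also have "\<dots> \<in> span {x}"
      unfolding *[symmetric] by (intro span_scale span_base) simp
    finally show False
      using assms(2) by simp
  qed
  with * assms(1) show "a = b"
    by (simp add: prod_eq_iff)
qed

lemma comb_independent_iff:
  assumes "x \<noteq> 0" "y \<notin> span {x}"
  shows "comb x y a \<noteq> 0 \<and> comb x y b \<notin> span {comb x y a} \<longleftrightarrow> det a b \<noteq> 0"
proof -
  have scale: "k *s comb x y a = comb x y (k * fst a, k * snd a)" for k
    by (simp add: comb_def scale_right_distrib)
  have "comb x y b \<in> span {comb x y a} \<longleftrightarrow> (\<exists>k. b = (k * fst a, k * snd a))"
    using inj_comb[OF assms] by (auto simp: span_singleton scale inj_eq)
  moreover have "comb x y a = 0 \<longleftrightarrow> a = 0"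
    using inj_eq[OF inj_comb[OF assms], of a 0] by (simp add: comb_def)
  moreover have "det a b = 0 \<longleftrightarrow> a = 0 \<or> (\<exists>k. b = (k * fst a, k * snd a))"
  proof
    assume "det a b = 0"
    then have eq: "fst a * snd b = fst b * snd a"
      by (simp add: det_def add_eq_0)
    consider "a = 0" | "fst a \<noteq> 0" | "snd a \<noteq> 0"
      by (auto simp: prod_eq_iff)
    then show "a = 0 \<or> (\<exists>k. b = (k * fst a, k * snd a))"
    proof cases
      case 2
      with eq show ?thesis
        by (intro disjI2 exI[of _ "fst b / fst a"]) (simp add: prod_eq_iff field_simps)
    next
      case 3
      with eq show ?thesis
        by (intro disjI2 exI[of _ "snd b / snd a"]) (simp add: prod_eq_iff field_simps)
    qed simp
  qed (auto simp: det_def add_eq_0)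
  ultimately show ?thesis
    by blast
qed

lemma span_comb_pair:
  assumes "det a b \<noteq> 0"
  shows "span {comb x y a, comb x y b} = span {x, y}"
proof
  show "span {comb x y a, comb x y b} \<subseteq> span {x, y}"
    by (intro span_minimal subspace_span) (simp add: span_pair)
  \<comment> \<open>Cramer's rule, with the signs dropped in characteristic 2.\<close>
  have "det a b *s x = snd b *s comb x y a + snd a *s comb x y b"
    "det a b *s y = fst b *s comb x y a + fst a *s comb x y b"
    by (simp_all add: det_def comb_def scale_right_distrib scale_left_distrib vec.two_simps
        mult.commute add.commute add.left_commute)
  then have "det a b *s x \<in> span {comb x y a, comb x y b}" "det a b *s y \<in> span {comb x y a, comb x y b}"
    by (simp_all add: span_add span_scale span_base)
  from this[THEN span_scale, of "inverse (det a b)"] assms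
  have "x \<in> span {comb x y a, comb x y b}" "y \<in> span {comb x y a, comb x y b}"
    by simp_all
  then show "span {x, y} \<subseteq> span {comb x y a, comb x y b}"
    by (intro span_minimal) auto
qed

lemma span_line: "span (line x y) = span {x, y}"
proof
  show "span (line x y) \<subseteq> span {x, y}"
    by (intro span_minimal) (auto simp: line_def span_zero span_base span_add)
  show "span {x, y} \<subseteq> span (line x y)"
    by (intro span_mono) (auto simp: line_def)
qed

lemma plane_fibre:
  assumes "x \<noteq> 0" "y \<notin> span {x}"
  shows "{U \<in> plane_lines. span U = span {x, y}} = (`) (comb x y) ` lines"
proof (intro equalityI subsetI)
  fix U assume "U \<in> {U \<in> plane_lines. span U = span {x, y}}"
  then obtain v w where vw: "U = line v w" "v \<noteq> 0" "w \<notin> span {v}" "span {v, w} = span {x, y}"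
    unfolding plane_lines_def by (auto simp: span_line)
  then have "v \<in> range (comb x y)" "w \<in> range (comb x y)"
    using span_base[of v "{v, w}"] span_base[of w "{v, w}"] by (simp_all add: span_pair)
  then obtain a b where ab: "v = comb x y a" "w = comb x y b"
    by blast
  with vw comb_independent_iff[OF assms, of a b] have "det a b \<noteq> 0"
    by simp
  then have "line a b \<in> lines"
    by (simp add: line_in_lines_iff)
  moreover have "U = comb x y ` line a b"
    by (simp add: vw ab image_line[of "comb x y", OF comb_add])
  ultimately show "U \<in> (`) (comb x y) ` lines"
    by blast
next
  fix U assume "U \<in> (`) (comb x y) ` lines"
  then obtain a b where ab: "U = comb x y ` line a b" "det a b \<noteq> 0"
    unfolding lines_def by blast
  then have "U = line (comb x y a) (comb x y b)"
    by (simp add: image_line[of "comb x y", OF comb_add])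
  moreover have "comb x y a \<noteq> 0 \<and> comb x y b \<notin> span {comb x y a}"
    unfolding comb_independent_iff[OF assms] by (rule ab(2))
  ultimately show "U \<in> {U \<in> plane_lines. span U = span {x, y}}"
    using span_comb_pair[OF ab(2)] unfolding plane_lines_def by (auto simp: span_line)
qed

text \<open>Sorted by their span over F, the lines fall into copies of \<open>lines\<close>,
  whatever the dimension of the space.\<close>

lemma triangulable_plane_lines: "triangulable plane_lines"
proof (rule triangulable_fibres)
  fix U assume "U \<in> plane_lines"
  then obtain x y where xy: "U = line x y" "x \<noteq> 0" "y \<notin> span {x}"
    unfolding plane_lines_def by blast
  obtain z :: 'f where "z ^ 6 + z ^ 3 + 1 = 0"
    using exists_root by blast
  then interpret field_64_root "TYPE('f)" z "z ^ 3"
    by unfold_locales simp_all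
  show "triangulable {U' \<in> plane_lines. span U' = span U}"
    unfolding xy(1) span_line plane_fibre[OF xy(2,3)]
    by (rule triangulable_image[OF triangulable_lines inj_comb[OF xy(2,3)] comb_add])
qed

end

section \<open>Assembly of the group divisible triangle design\<close>

theorem theorem8:
  fixes scale :: "'f::{field, finite} \<Rightarrow> 'v::ab_group_add \<Rightarrow> 'v"
    and k :: nat
  assumes "card (UNIV :: 'f set) = 2 ^ 6"
    and "vector_space scale"
    and "vector_space.dim scale UNIV = k"
    and "k > 0"
  shows "\<exists>blocks. group_divisible_triangle_design (scale_bit scale) (6 * k) 6
    {W. module.subspace scale W \<and> vector_space.dim scale W = 1} blocks"
proof -
  interpret vector_space_64 scale
    using assms(1,2) by (simp add: vector_space_64_def field_64_def)
  let ?G = "{W. subspace W \<and> dim W = 1}"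
  obtain S where S: "independent S" "UNIV \<subseteq> span S" "card S = k"
    using basis_exists[of UNIV] assms(3) by metis
  \<comment> \<open>Infinite sets have cardinality 0 by default, so \<open>k > 0\<close> gives
    finiteness.\<close>
  have "finite S"
    using S(3) assms(4) by (simp add: card_ge_0_finite)
  then have "card (UNIV :: 'v set) = (2 ^ 6) ^ k"
    using card_span_independent[of S] S assms(1) by (simp add: top.extremum_unique)
  then have finite: "finite (UNIV :: 'v set)"
    by (simp add: card_ge_0_finite)
  then have finite': "finite X" for X :: "'v set"
    by (rule rev_finite_subset) simp
  have card_F: "card W = (2 ^ 6) ^ dim W" if "subspace W" for W
  proof -
    obtain B where "B \<subseteq> W" "independent B" "W \<subseteq> span B" "card B = dim W"
      using basis_exists by blast
    moreover from this that have "W = span B"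
      by (metis span_minimal subset_antisym)
    ultimately show ?thesis
      using card_span_independent[of B] finite' assms(1) by simp
  qed
  have card_bit: "card W = 2 ^ bit.dim W" if "bit.subspace W" for W
  proof -
    obtain B where "B \<subseteq> W" "bit.independent B" "W \<subseteq> bit.span B" "card B = bit.dim W"
      using bit.basis_exists by blast
    moreover from this that have "W = bit.span B"
      by (metis bit.span_minimal subset_antisym)
    moreover have "card (UNIV :: bit set) = 2"
    proof -
      have "(UNIV :: bit set) = {0, 1}"
        by (metis (full_types) UNIV_eq_I bit.exhaust insertCI)
      then have "card (UNIV :: bit set) = card {0, 1 :: bit}"
        by (rule arg_cong)
      then show ?thesis
        by (simp only: card_2_iff') auto
    qed
    ultimately show ?thesis
      using bit.card_span_independent[of B] finite' by simp
  qed
  have bit_subspace: "bit.subspace W" if "subspace W" for W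
    using that unfolding bit.subspace_def by (simp add: scale_bit_eq subspace_0 subspace_add)
  have bit_dim: "bit.dim W = 6 * dim W" if "subspace W" for W
  proof -
    \<comment> \<open>The same set is counted over both fields.\<close>
    have "(2::nat) ^ bit.dim W = 2 ^ (6 * dim W)"
      using card_F[OF that] card_bit[OF bit_subspace[OF that]] by (simp add: power_mult)
    then show ?thesis
      by simp
  qed
  \<comment> \<open>A group has as many elements as \<open>span {v}\<close>, so each of its nonzero
    vectors determines it.\<close>
  have group_eq: "W = span {v}" if W: "W \<in> ?G" and v: "v \<in> W" "v \<noteq> 0" for W v
  proof -
    have "card (span {v}) = card W"
      using card_span_independent[of "{v}"] card_F[of W] W v assms(1)
      by (simp add: dependent_single)
    moreover have "span {v} \<subseteq> W"
      using W v by (intro span_minimal) auto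
    ultimately show ?thesis
      using finite' by (metis card_subset_eq)
  qed
  have group_span: "span {v} \<in> ?G" if "v \<noteq> 0" for v
    using that by (simp add: dim_eq_card_independent dependent_single)
  obtain B where B: "\<And>T. T \<in> B \<Longrightarrow> is_triangle T \<and> T \<subseteq> plane_lines"
      "\<And>U. U \<in> plane_lines \<Longrightarrow> \<exists>!T. T \<in> B \<and> U \<in> T"
    using triangulable_plane_lines unfolding triangulable_def by metis
  have "group_divisible_triangle_design (scale_bit scale) (6 * k) 6 ?G B"
  proof
    show "6 dvd 6 * k"
      by simp
    show "\<exists>S. finite S \<and> bit.span S = UNIV"
      using finite by (intro exI[of _ UNIV]) simp
    show "bit.dim UNIV = 6 * k"
      using bit_dim[of UNIV] assms(3) by simp
    show "bit.subspace W \<and> bit.dim W = 6" if "W \<in> ?G" for W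
      using that by (simp add: bit_subspace bit_dim)
    show "\<exists>!W. W \<in> ?G \<and> v \<in> W" if "v \<noteq> 0" for v
    proof (rule ex1I)
      show "span {v} \<in> ?G \<and> v \<in> span {v}"
        using group_span[OF that] by (simp add: span_base)
    qed (use group_eq that in blast)
    show "bit.triangle T" if "T \<in> B" for T
      using B(1)[OF that] bit_triangle by blast
  next
    fix U assume U: "bit.subspace U" "bit.dim U = 2"
    then obtain X where X: "X \<subseteq> U" "bit.independent X" "U \<subseteq> bit.span X" "card X = 2"
      using bit.basis_exists[of U] by metis
    then obtain x y where xy: "X = {x, y}" "x \<noteq> y"
      by (auto simp: card_2_iff)
    have "U = bit.span X"
      using X U by (metis bit.span_minimal subset_antisym)
    then have U_eq: "U = line x y"
      by (simp add: xy bit_span_pair)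
    have nz: "x \<noteq> 0" "y \<noteq> 0"
      using X(2) xy by (simp_all add: bit_independent_pair)
    have mem: "x \<in> U" "y \<in> U"
      by (simp_all add: U_eq line_def)
    show "(\<exists>!T. T \<in> B \<and> U \<in> T) \<and> \<not> (\<exists>W\<in>?G. U \<subseteq> W) \<or>
        \<not> (\<exists>T\<in>B. U \<in> T) \<and> (\<exists>!W. W \<in> ?G \<and> U \<subseteq> W)"
    proof (cases "y \<in> span {x}")
      case False
      then have "U \<in> plane_lines"
        using nz U_eq unfolding plane_lines_def by blast
      moreover have "\<not> (\<exists>W\<in>?G. U \<subseteq> W)"
        using group_eq nz(1) mem False by blast
      ultimately show ?thesis
        using B(2) by blast
    next
      case True
      have sub: "U \<subseteq> span {x}"
        using True by (simp add: U_eq line_def span_zero span_base span_add)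
      \<comment> \<open>A nonzero \<open>v\<close> in \<open>U\<close> spans the same group as
        \<open>x\<close>, and this group contains all of \<open>U\<close>.\<close>
      have "U \<notin> plane_lines"
      proof
        assume "U \<in> plane_lines"
        then obtain v w where vw: "U = line v w" "v \<noteq> 0" "w \<notin> span {v}"
          unfolding plane_lines_def by blast
        then have "v \<in> span {x}" "w \<in> span {x}"
          using sub by (simp_all add: line_def)
        with vw group_eq[OF group_span[OF nz(1)], of v] show False
          by simp
      qed
      then have "\<not> (\<exists>T\<in>B. U \<in> T)"
        using B(1) by blast
      moreover have "\<exists>!W. W \<in> ?G \<and> U \<subseteq> W"
      proof (rule ex1I)
        show "span {x} \<in> ?G \<and> U \<subseteq> span {x}"
          using group_span[OF nz(1)] sub by blast
      qed (use group_eq nz(1) mem in blast)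
      ultimately show ?thesis
        by blast
    qed
  qed
  then show ?thesis ..
qed

end
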